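(* Let $(X,d,m)$ be an Ahlfors $N$-regular metric measure space with $m(X)=\infty$, and let $F\subset X$ be a closed subset and $\mu$ a Borel measure supported in $F$ such that $(F,d|_{F\times F},\mu)$ is Ahlfors $\delta$-regular, $0<\delta<N$. Let $\alpha_0\in(0,1)$ be the number described in the context. If $\alpha<\alpha_0$, $1<p<\infty$ and $\beta=\alpha-\frac{N-\delta}{p}>0$, then for $1\leq q<\infty$ there exists a continuous linear operator $$\mathcal{R}:B^\alpha_{p,q}(X,m)\to B^\beta_{p,q}(F,\mu)$$ such that $\mathcal{R}f=f|_F$ for $f$ continuous.
   Context: Ahlfors regularity: a metric measure space $(Y,d,\nu)$ is Ahlfors $M$-regular ($M>0$) if there is $C>0$ with $C^{-1}r^M\leq\nu(B(x,2r))\leq Cr^M$ for each $x\in Y$ and $0<r<\mathrm{diam}(Y)$. Besov spaces: for a metric measure space $(Y,d,\nu)$ (here $(X,d,m)$ or $(F,d,\mu)$), $E_pf(t)=\left(\int_Y\frac{1}{\nu(B(x,t))}\int_{B(x,t)}|f(y)-f(x)|^pd\nu(y)d\nu(x)\right)^{1/p}$ for $t>0$, and $B^\alpha_{p,q}(Y,\nu)$ is the space of $f$ with $\|f\|_{B^\alpha_{p,q}}=\|f\|_{L^p(\nu)}+\left(\int_0^\infty(t^{-\alpha}E_pf(t))^q\frac{dt}{t}\right)^{1/q}<\infty$. Approximation of the identity: $(S_t)_{t>0}$, $S_tf(x)=\int_X s(x,y,t)f(y)\,dm(y)$, is a Coifman-type approximation of the identity on $X$, as constructed in the literature for Ahlfors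 $N$-regular spaces with $m(X)=\infty$. Put $q(x,y,t)=-t\frac{d}{dt}s(x,y,t)$ and $Q_tf(x)=\int_X q(x,y,t)f(y)\,dm(y)$; these satisfy $Q_t1\equiv0$; $q(x,y,t)=q(y,x,t)$; $|q(x,y,t)|\leq Ct^{-N}$; $q(x,y,t)=0$ if $d(x,y)>4t$; $|q(x,y,t)-q(x',y,t)|\leq C't^{-N-1}d(x,x')$; and $Q_t$ maps $L^p$ to $L^p$. (One standard construction, as an example: take $h:[0,\infty)\to[0,1]$ nonincreasing and $C^\infty$ with $h\equiv1$ on $[0,1/2]$ and $h\equiv0$ on $[2,\infty)$, $T_tf(x)=t^{-N}\int_X h(d(x,y)/t)f(y)\,dm(y)$, $\varphi(x,t)=1/T_t1(x)$, $\psi(x,t)=1/T_t(\varphi(\cdot,t))(x)$, and $s(x,y,t)=\frac{\varphi(x,t)\varphi(y,t)}{t^{2N}}\int_X h(\frac{d(x,z)}{t})h(\frac{d(y,z)}{t})\psi(z,t)\,dm(z)$.) Potential spaces: $k_\alpha(x,y)=\int_0^\infty\frac{\alpha t^\alpha}{(1+t^\alpha)^2}s(x,y,t)\frac{dt}{t}$, $J_\alpha g(x)=\int_X g(y)k_\alpha(x,y)\,dm(y)$, bounded on $L^p(X,m)$; $L^{\alpha,p}=J_\alpha(L^p)$ with norm $\|f\|_{\alpha,p}=\|f\|_p+\inf\{\|g\|_p: f=J_\alpha g\}$. Fractional derivative: $D_\alpha f(x)=\int_0^\infty t^{-\alpha}Q_tf(x)\frac{dt}{t}$, equivalently $D_\alpha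 f(x)=\int_X (f(x)-f(y))n_\alpha(x,y)\,dm(y)$ with $n_\alpha(x,y)=\int_0^\infty\alpha t^{-\alpha}s(x,y,t)\frac{dt}{t}$. The number $\alpha_0\in(0,1)$ (whose existence is a known result) is such that for all $1<p<\infty$ and $0<\alpha<\alpha_0$: $f\in L^{\alpha,p}$ if and only if $f,D_\alpha f\in L^p$, and furthermore $\|f\|_{\alpha,p}\sim\|(I+D_\alpha)f\|_p$. *)

theory Defs
  imports "HOL-Analysis.Analysis"
begin

(* A metric measure space (Y, d, nu) is a measure nu on a subset Y = space nu of a metric space,
   with the Borel sigma-algebra of Y.  Thus X is the whole type, and (F, d|F, mu) is
   restrict_space mu F.  Balls of Y are  ball x r \<inter> space nu. *)

definition ediam :: "'a::metric_space set \<Rightarrow> ennreal" where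
  "ediam Y = (SUP x\<in>Y. SUP y\<in>Y. ennreal (dist x y))"

(* The diameter is taken in [0, \<infinity>], since the library's diameter is unspecified on unbounded
   sets.  Spaces of diameter 0 (empty or one point) are excluded: on them the two-sided bound
   quantifies over an empty range of radii and would hold for every exponent M and every nu. *)
definition ahlfors_regular :: "real \<Rightarrow> 'a::metric_space measure \<Rightarrow> bool" where
  "ahlfors_regular M \<nu> \<longleftrightarrow>
     M > 0 \<and> sets \<nu> = sets (restrict_space borel (space \<nu>)) \<and> ediam (space \<nu>) > 0 \<and>
     (\<exists>C>0. \<forall>x\<in>space \<nu>. \<forall>r>0. ennreal r < ediam (space \<nu>) \<longrightarrow>
        ennreal (r powr M / C) \<le> emeasure \<nu> (ball x (2 * r) \<inter> space \<nu>) \<and>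
        emeasure \<nu> (ball x (2 * r) \<inter> space \<nu>) \<le> ennreal (C * r powr M))"

(* Only used with a > 0. *)
definition ennpowr :: "ennreal \<Rightarrow> real \<Rightarrow> ennreal" where
  "ennpowr x a = (if x = \<infinity> then \<infinity> else ennreal (enn2real x powr a))"


section \<open>Lebesgue and Besov spaces\<close>

(* Function spaces are sets of functions, not of a.e.-classes; norms take values in [0, \<infinity>]. *)

definition lp_norm :: "real \<Rightarrow> 'a measure \<Rightarrow> ('a \<Rightarrow> real) \<Rightarrow> ennreal" where
  "lp_norm p \<nu> f = ennpowr (\<integral>\<^sup>+x. ennreal (\<bar>f x\<bar> powr p) \<partial>\<nu>) (1 / p)"

definition lp_space :: "real \<Rightarrow> 'a measure \<Rightarrow> ('a \<Rightarrow> real) set" where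
  "lp_space p \<nu> = {f \<in> borel_measurable \<nu>. lp_norm p \<nu> f < \<infinity>}"

definition besov_E :: "real \<Rightarrow> 'a::metric_space measure \<Rightarrow> ('a \<Rightarrow> real) \<Rightarrow> real \<Rightarrow> ennreal" where
  "besov_E p \<nu> f t = ennpowr
     (\<integral>\<^sup>+x. (1 / emeasure \<nu> (ball x t \<inter> space \<nu>)) *
        (\<integral>\<^sup>+y\<in>ball x t. ennreal (\<bar>f y - f x\<bar> powr p) \<partial>\<nu>) \<partial>\<nu>) (1 / p)"

definition besov_norm ::
  "real \<Rightarrow> real \<Rightarrow> real \<Rightarrow> 'a::metric_space measure \<Rightarrow> ('a \<Rightarrow> real) \<Rightarrow> ennreal" where
  "besov_norm \<alpha> p q \<nu> f = lp_norm p \<nu> f +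
     ennpowr (\<integral>\<^sup>+t\<in>{0<..}. ennpowr (ennreal (t powr (- \<alpha>)) * besov_E p \<nu> f t) q * ennreal (1 / t)
       \<partial>lborel) (1 / q)"

definition besov_space ::
  "real \<Rightarrow> real \<Rightarrow> real \<Rightarrow> 'a::metric_space measure \<Rightarrow> ('a \<Rightarrow> real) set" where
  "besov_space \<alpha> p q \<nu> = {f \<in> borel_measurable \<nu>. besov_norm \<alpha> p q \<nu> f < \<infinity>}"

(* R is a continuous linear operator between the spaces of a.e.-classes of V (norm nV, measure \<nu>)
   and W (norm nW, measure \<omega>), written on representatives: R respects a.e. equality and is linear
   up to a.e. equality. *)
definition continuous_linear_operator ::
  "'a measure \<Rightarrow> ('a \<Rightarrow> real) set \<Rightarrow> (('a \<Rightarrow> real) \<Rightarrow> ennreal) \<Rightarrow>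
   'b measure \<Rightarrow> ('b \<Rightarrow> real) set \<Rightarrow> (('b \<Rightarrow> real) \<Rightarrow> ennreal) \<Rightarrow>
   (('a \<Rightarrow> real) \<Rightarrow> 'b \<Rightarrow> real) \<Rightarrow> bool" where
  "continuous_linear_operator \<nu> V nV \<omega> W nW R \<longleftrightarrow>
     (\<forall>f\<in>V. R f \<in> W) \<and>
     (\<forall>f\<in>V. \<forall>g\<in>V. (AE x in \<nu>. f x = g x) \<longrightarrow> (AE x in \<omega>. R f x = R g x)) \<and>
     (\<forall>f\<in>V. \<forall>g\<in>V. AE x in \<omega>. R (\<lambda>y. f y + g y) x = R f x + R g x) \<and>
     (\<forall>c. \<forall>f\<in>V. AE x in \<omega>. R (\<lambda>y. c * f y) x = c * R f x) \<and>
     (\<forall>f\<in>V. \<forall>\<epsilon>>0. \<exists>\<eta>>0. \<forall>g\<in>V. nV (\<lambda>y. g y - f y) < ennreal \<eta> \<longrightarrow>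
        nW (\<lambda>x. R g x - R f x) < ennreal \<epsilon>)"


section \<open>Approximations of the identity\<close>

definition S_op :: "'a measure \<Rightarrow> ('a \<Rightarrow> 'a \<Rightarrow> real \<Rightarrow> real) \<Rightarrow> real \<Rightarrow> ('a \<Rightarrow> real) \<Rightarrow> 'a \<Rightarrow> real" where
  "S_op m s t f x = (\<integral>y. s x y t * f y \<partial>m)"

definition q_ker :: "('a \<Rightarrow> 'a \<Rightarrow> real \<Rightarrow> real) \<Rightarrow> 'a \<Rightarrow> 'a \<Rightarrow> real \<Rightarrow> real" where
  "q_ker s x y t = - t * deriv (s x y) t"

definition Q_op :: "'a measure \<Rightarrow> ('a \<Rightarrow> 'a \<Rightarrow> real \<Rightarrow> real) \<Rightarrow> real \<Rightarrow> ('a \<Rightarrow> real) \<Rightarrow> 'a \<Rightarrow> real" where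
  "Q_op m s t f x = (\<integral>y. q_ker s x y t * f y \<partial>m)"

(* Coifman-type approximations of the identity, described by the properties of q = -t ds/dt and
   Q_t, together with S_t 1 = 1 and S_t f \<rightarrow> f in L^p as t \<rightarrow> 0.  No particular construction is
   singled out; on an N-regular space of infinite measure the kernel
     s(x,y,t) = phi(x,t) phi(y,t) t^(-2N) \<integral> h(d(x,z)/t) h(d(y,z)/t) psi(z,t) dm(z),
   where h is a smooth nonincreasing cutoff (1 on [0,1/2], 0 on [2,\<infinity>)),
   T_t f(x) = t^(-N) \<integral> h(d(x,y)/t) f(y) dm(y), phi = 1 / T_t 1 and psi = 1 / T_t phi,
   is an instance. *)
definition approx_identity ::
  "real \<Rightarrow> 'a::metric_space measure \<Rightarrow> ('a \<Rightarrow> 'a \<Rightarrow> real \<Rightarrow> real) \<Rightarrow> bool" where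
  "approx_identity N m s \<longleftrightarrow>
     (\<forall>t>0. \<forall>x. S_op m s t (\<lambda>_. 1) x = 1) \<and>
     (\<forall>p\<ge>1. \<forall>f\<in>lp_space p m. (\<forall>t>0. S_op m s t f \<in> lp_space p m) \<and>
        ((\<lambda>t. lp_norm p m (\<lambda>x. S_op m s t f x - f x)) \<longlongrightarrow> 0) (at_right 0)) \<and>
     (\<forall>x y. \<forall>t>0. s x y differentiable at t) \<and>
     (\<forall>t>0. \<forall>x. Q_op m s t (\<lambda>_. 1) x = 0) \<and>
     (\<forall>t>0. \<forall>x y. q_ker s x y t = q_ker s y x t) \<and>
     (\<exists>C. \<forall>t>0. \<forall>x y. \<bar>q_ker s x y t\<bar> \<le> C * t powr (- N)) \<and>
     (\<forall>t>0. \<forall>x y. dist x y > 4 * t \<longrightarrow> q_ker s x y t = 0) \<and>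
     (\<exists>C. \<forall>t>0. \<forall>x x' y. \<bar>q_ker s x y t - q_ker s x' y t\<bar> \<le> C * t powr (- N - 1) * dist x x') \<and>
     (\<forall>p\<ge>1. \<forall>t>0. \<forall>f\<in>lp_space p m. Q_op m s t f \<in> lp_space p m)"


section \<open>Potential spaces and the fractional derivative\<close>

definition k_ker :: "('a \<Rightarrow> 'a \<Rightarrow> real \<Rightarrow> real) \<Rightarrow> real \<Rightarrow> 'a \<Rightarrow> 'a \<Rightarrow> real" where
  "k_ker s \<alpha> x y =
     (LINT t:{0<..}|lborel. \<alpha> * t powr \<alpha> / (1 + t powr \<alpha>)\<^sup>2 * s x y t * (1 / t))"

definition J_op :: "'a measure \<Rightarrow> ('a \<Rightarrow> 'a \<Rightarrow> real \<Rightarrow> real) \<Rightarrow> real \<Rightarrow> ('a \<Rightarrow> real) \<Rightarrow> 'a \<Rightarrow> real" where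
  "J_op m s \<alpha> g x = (\<integral>y. g y * k_ker s \<alpha> x y \<partial>m)"

definition potential_space ::
  "'a measure \<Rightarrow> ('a \<Rightarrow> 'a \<Rightarrow> real \<Rightarrow> real) \<Rightarrow> real \<Rightarrow> real \<Rightarrow> ('a \<Rightarrow> real) set" where
  "potential_space m s \<alpha> p =
     {f \<in> borel_measurable m. \<exists>g\<in>lp_space p m. AE x in m. f x = J_op m s \<alpha> g x}"

definition potential_norm ::
  "'a measure \<Rightarrow> ('a \<Rightarrow> 'a \<Rightarrow> real \<Rightarrow> real) \<Rightarrow> real \<Rightarrow> real \<Rightarrow> ('a \<Rightarrow> real) \<Rightarrow> ennreal" where
  "potential_norm m s \<alpha> p f = lp_norm p m f +
     (INF g\<in>{g \<in> lp_space p m. AE x in m. f x = J_op m s \<alpha> g x}. lp_norm p m g)"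

(* D_\<alpha> f = h for f, h in L^p.  For f in L^p the integral of t^(-\<alpha>) Q_t f dt/t over [\<epsilon>, \<infinity>)
   converges absolutely, but the integral over (0, \<infinity>) in general does not, not even for f in the
   potential space; it is therefore the improper integral, with the limit \<epsilon> \<rightarrow> 0 taken in L^p.
   A Bochner integral over (0, \<infinity>) would be 0 by convention wherever it diverges. *)
definition has_frac_deriv ::
  "'a measure \<Rightarrow> ('a \<Rightarrow> 'a \<Rightarrow> real \<Rightarrow> real) \<Rightarrow> real \<Rightarrow> real \<Rightarrow> ('a \<Rightarrow> real) \<Rightarrow> ('a \<Rightarrow> real) \<Rightarrow> bool" where
  "has_frac_deriv m s \<alpha> p f h \<longleftrightarrow>
     ((\<lambda>\<epsilon>. lp_norm p m
        (\<lambda>x. (LINT t:{\<epsilon>..}|lborel. t powr (- \<alpha>) * Q_op m s t f x * (1 / t)) - h x))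
      \<longlongrightarrow> 0) (at_right 0)"

(* The defining property of the exponent \<alpha>\<^sub>0. *)
definition potential_exponent ::
  "'a measure \<Rightarrow> ('a \<Rightarrow> 'a \<Rightarrow> real \<Rightarrow> real) \<Rightarrow> real \<Rightarrow> bool" where
  "potential_exponent m s \<alpha>\<^sub>0 \<longleftrightarrow> 0 < \<alpha>\<^sub>0 \<and> \<alpha>\<^sub>0 < 1 \<and>
     (\<forall>p>1. \<forall>\<alpha>. 0 < \<alpha> \<and> \<alpha> < \<alpha>\<^sub>0 \<longrightarrow>
        (\<forall>f. f \<in> potential_space m s \<alpha> p \<longleftrightarrow>
           f \<in> lp_space p m \<and> (\<exists>h\<in>lp_space p m. has_frac_deriv m s \<alpha> p f h)) \<and>
        (\<exists>C>0. \<forall>f\<in>potential_space m s \<alpha> p. \<forall>h\<in>lp_space p m. has_frac_deriv m s \<alpha> p f h \<longrightarrow>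
           potential_norm m s \<alpha> p f \<le> ennreal C * lp_norm p m (\<lambda>x. f x + h x) \<and>
           lp_norm p m (\<lambda>x. f x + h x) \<le> ennreal C * potential_norm m s \<alpha> p f))"

end

theory Submission
  imports Defs
begin

text \<open>
  The trace is defined directly, without the potential spaces: \<open>\<R> f(x)\<close> is the limit of the averages
  \<open>A\<^sub>k f(x)\<close> of \<open>f\<close> over \<open>B(x, 2\<^sup>-\<^sup>k)\<close> with respect to \<open>m\<close>, so \<open>\<R> f = f\<close> on \<open>F\<close> for continuous \<open>f\<close>.
  Jensen's inequality bounds \<open>|A\<^sub>k\<^sub>+\<^sub>1 f(x) - A\<^sub>k f(x)|\<^sup>p\<close> by the mean of \<open>|f(y) - f(z)|\<^sup>p\<close> over a
  product of balls; integrating in \<open>x\<close> against \<open>\<mu>\<close>, exchanging the integrals and using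
  \<open>\<mu>(B(y, r)) \<le> K r\<^sup>\<delta>\<close> gives \<open>\<parallel>A\<^sub>k\<^sub>+\<^sub>1 f - A\<^sub>k f\<parallel>\<^sub>p\<^sup>p \<le> c 2\<^sup>-\<^sup>k\<^sup>\<beta>\<^sup>p b\<^sub>k\<close>, where \<open>b\<^sub>k\<close> is comparable to
  \<open>(2\<^sup>k\<^sup>\<alpha> E\<^sub>p f(2\<^sup>-\<^sup>k))\<^sup>p\<close>. As \<open>\<beta> > 0\<close>, the increments are summable, and comparing \<open>\<R> f\<close> with \<open>A\<^sub>k f\<close> at
  the scale \<open>t \<sim> 2\<^sup>-\<^sup>k\<close> bounds \<open>E\<^sub>p(\<R> f)(t)\<^sup>p\<close> on \<open>F\<close> by \<open>c 2\<^sup>-\<^sup>k\<^sup>\<beta>\<^sup>p \<Sum>\<^sub>i 2\<^sup>-\<^sup>i\<^sup>\<beta> b\<^sub>k\<^sub>+\<^sub>i\<close>.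
  A discrete Hardy inequality with exponent \<open>q / p\<close> then bounds the Besov norm of \<open>\<R> f\<close>; for \<open>t > 1\<close> the
  \<open>L\<^sup>p\<close> norm of \<open>\<R> f\<close> suffices.
\<close>

section \<open>Powers and Jensen's inequality in the extended nonnegative reals\<close>

lemma ennpowr_ennreal: "a > 0 \<Longrightarrow> 0 \<le> x \<Longrightarrow> ennpowr (ennreal x) a = ennreal (x powr a)"
  by (simp add: ennpowr_def)

lemma ennpowr_top [simp]: "ennpowr top a = top"
  by (simp add: ennpowr_def)

lemma ennpowr_0 [simp]: "ennpowr 0 a = 0"
  by (simp add: ennpowr_def)

lemma ennpowr_1 [simp]: "ennpowr x 1 = x"
  by (cases x) (auto simp: ennpowr_def)

lemma ennpowr_mono: "a > 0 \<Longrightarrow> x \<le> y \<Longrightarrow> ennpowr x a \<le> ennpowr y a"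
  by (cases x; cases y) (auto simp: ennpowr_ennreal powr_mono2 top_unique)

lemma ennpowr_mult:
  assumes "a > 0" shows "ennpowr (x * y) a = ennpowr x a * ennpowr y a"
proof (cases x; cases y)
  fix u v assume "x = ennreal u" "y = ennreal v" "0 \<le> u" "0 \<le> v"
  then show ?thesis
    using assms by (simp flip: ennreal_mult add: ennpowr_ennreal powr_mult)
next
  fix u assume "x = ennreal u" "0 \<le> u" "y = top"
  then show ?thesis
    using assms by (cases "u = 0") (auto simp: ennreal_mult_top ennpowr_ennreal)
next
  fix u assume "y = ennreal u" "0 \<le> u" "x = top"
  then show ?thesis
    using assms by (cases "u = 0") (auto simp: ennreal_top_mult ennpowr_ennreal)
qed auto

lemma ennpowr_ennpowr: "a > 0 \<Longrightarrow> b > 0 \<Longrightarrow> ennpowr (ennpowr x a) b = ennpowr x (a * b)"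
  by (cases x) (auto simp: ennpowr_ennreal powr_powr)

text \<open>Concavity: after division by \<open>u + v\<close> both arguments lie in [0, 1] and add
  up to 1, and there \<open>w \<le> w powr a\<close> because \<open>a \<le> 1\<close>.\<close>

lemma ennpowr_add_le_1:
  assumes a: "0 < a" "a \<le> 1" shows "ennpowr (x + y) a \<le> ennpowr x a + ennpowr y a"
proof (cases x; cases y)
  fix u v assume uv: "x = ennreal u" "y = ennreal v" "0 \<le> u" "0 \<le> v"
  have "(u + v) powr a \<le> u powr a + v powr a"
  proof (cases "u + v = 0")
    case False
    with uv have s: "u + v > 0" by auto
    have le: "w / (u + v) \<le> (w / (u + v)) powr a" if "0 \<le> w" "w \<le> u + v" for w
      using powr_mono'[of a 1 "w / (u + v)"] that s a by simp
    have "1 = u / (u + v) + v / (u + v)"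
      using s by (simp flip: add_divide_distrib)
    also have "\<dots> \<le> (u / (u + v)) powr a + (v / (u + v)) powr a"
      using uv by (intro add_mono le) auto
    also have "\<dots> = (u powr a + v powr a) / (u + v) powr a"
      using uv by (simp add: powr_divide add_divide_distrib)
    finally show ?thesis
      using s by (simp add: field_simps)
  qed (use uv in auto)
  then show ?thesis
    using uv a by (simp add: ennpowr_ennreal flip: ennreal_plus)
qed auto

lemma measurable_ennpowr [measurable]:
  assumes [measurable]: "f \<in> borel_measurable M"
  shows "(\<lambda>x. ennpowr (f x) a) \<in> borel_measurable M"
  unfolding ennpowr_def by measurable

lemma ennpowr_le_iff:
  assumes "a > 0" shows "ennpowr x a \<le> y \<longleftrightarrow> x \<le> ennpowr y (1 / a)"
proof
  assume "ennpowr x a \<le> y"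
  then have "ennpowr (ennpowr x a) (1 / a) \<le> ennpowr y (1 / a)"
    using assms by (intro ennpowr_mono) auto
  then show "x \<le> ennpowr y (1 / a)"
    using assms by (simp add: ennpowr_ennpowr)
next
  assume "x \<le> ennpowr y (1 / a)"
  then have "ennpowr x a \<le> ennpowr (ennpowr y (1 / a)) a"
    using assms by (intro ennpowr_mono) auto
  then show "ennpowr x a \<le> y"
    using assms by (simp add: ennpowr_ennpowr)
qed

text \<open>The finite case is an induction. For the limit the exponent is moved to the other side,
  so that only a bound on all partial sums has to be checked.\<close>

lemma ennpowr_suminf_le:
  assumes a: "0 < a" "a \<le> 1"
  shows "ennpowr (\<Sum>i. f i) a \<le> (\<Sum>i. ennpowr (f i) a)"
proof -
  have fin: "ennpowr (\<Sum>i<n. f i) a \<le> (\<Sum>i<n. ennpowr (f i) a)" for n :: nat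
  proof (induction n)
    case (Suc n)
    then show ?case
      using ennpowr_add_le_1[OF a, of "\<Sum>i<n. f i" "f n"] by (auto intro: order_trans add_right_mono)
  qed auto
  have "(\<Sum>i. f i) \<le> ennpowr (\<Sum>i. ennpowr (f i) a) (1 / a)"
  proof (intro suminf_le_const summableI)
    fix n
    have "ennpowr (\<Sum>i<n. f i) a \<le> (\<Sum>i. ennpowr (f i) a)"
      using fin[of n] sum_le_suminf[OF summableI, of "{..<n}" "\<lambda>i. ennpowr (f i) a"]
      by (auto intro: order_trans)
    then show "(\<Sum>i<n. f i) \<le> ennpowr (\<Sum>i. ennpowr (f i) a) (1 / a)"
      using a by (simp add: ennpowr_le_iff)
  qed
  then show ?thesis
    using a by (simp add: ennpowr_le_iff)
qed

text \<open>Young's inequality \<open>c\<^sup>p\<^sup>-\<^sup>1 g \<le> g\<^sup>p / p + c\<^sup>p (p - 1) / p\<close>, applied with \<open>c\<close> the mean of \<open>g\<close>, gives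
  Jensen's inequality.\<close>

lemma nn_integral_Jensen:
  assumes p: "p > 1" and [measurable]: "g \<in> borel_measurable M" and fin: "emeasure M (space M) < \<infinity>"
  shows "ennpowr (\<integral>\<^sup>+x. g x \<partial>M) p \<le> ennpowr (emeasure M (space M)) (p - 1) * (\<integral>\<^sup>+x. ennpowr (g x) p \<partial>M)"
proof -
  obtain V where V: "emeasure M (space M) = ennreal V" "V \<ge> 0"
    using fin by (cases "emeasure M (space M)") auto
  show ?thesis
  proof (cases "V = 0")
    case True
    then have "(\<integral>\<^sup>+x. g x \<partial>M) = 0"
      using V by (subst nn_integral_0_iff_AE) (auto intro!: AE_I'[of "space M"] simp: null_sets_def)
    then show ?thesis by simp
  next
    case False
    with V have V0: "V > 0" by auto
    show ?thesis
    proof (cases "\<integral>\<^sup>+x. g x \<partial>M")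
      case (real I)
      define c where "c = I / V"
      have c: "c \<ge> 0" "I = c * V" using real V0 by (auto simp: c_def)
      have young: "ennreal (p * c powr (p - 1)) * g x \<le> ennpowr (g x) p + ennreal ((p - 1) * c powr p)" for x
      proof (cases "g x")
        case (real u)
        have "u * c powr (p - 1) \<le> u powr p / p + (c powr (p - 1)) powr (p / (p - 1)) / (p / (p - 1))"
          using p real c by (intro Youngs_inequality) (auto simp: field_simps)
        also have "(c powr (p - 1)) powr (p / (p - 1)) = c powr p"
          using p by (simp add: powr_powr)
        finally have "p * (u * c powr (p - 1)) \<le> p * (u powr p / p + c powr p / (p / (p - 1)))"
          using p by (intro mult_left_mono) auto
        also have "\<dots> = u powr p + (p - 1) * c powr p"
          using p by (simp add: field_simps)
        finally show ?thesis
          using p real by (simp add: ennpowr_ennreal mult_ac flip: ennreal_mult ennreal_plus)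
      qed auto
      have "ennreal (p * c powr (p - 1)) * ennreal I = (\<integral>\<^sup>+x. ennreal (p * c powr (p - 1)) * g x \<partial>M)"
        using real by (simp add: nn_integral_cmult)
      also have "\<dots> \<le> (\<integral>\<^sup>+x. ennpowr (g x) p + ennreal ((p - 1) * c powr p) \<partial>M)"
        by (intro nn_integral_mono young)
      also have "\<dots> = (\<integral>\<^sup>+x. ennpowr (g x) p \<partial>M) + ennreal ((p - 1) * c powr p) * ennreal V"
        by (subst nn_integral_add) (auto simp: V)
      finally have *: "ennreal (p * c powr (p - 1)) * ennreal I \<le>
        (\<integral>\<^sup>+x. ennpowr (g x) p \<partial>M) + ennreal ((p - 1) * c powr p) * ennreal V" .
      have cp: "c powr p = c powr (p - 1) * c" using powr_add[of c "p - 1" 1] c by simp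
      show ?thesis
      proof (cases "\<integral>\<^sup>+x. ennpowr (g x) p \<partial>M")
        case real2: (real J)
        have "p * c powr (p - 1) * I \<le> J + (p - 1) * c powr p * V"
          using * p real c V0 real2 by (simp flip: ennreal_mult ennreal_plus)
        \<comment> \<open>Since \<open>I = c * V\<close>, the left side is
          \<open>p * c powr p * V\<close>; subtracting the remainder
          \<open>(p - 1) * c powr p * V\<close> from Young's inequality leaves exactly
          \<open>c powr p * V\<close>.\<close>
        then have J: "c powr (p - 1) * c * V \<le> J"
          unfolding cp c(2) by (simp add: algebra_simps)
        have "I powr p = V powr (p - 1) * (c powr (p - 1) * c * V)"
          using powr_add[of V "p - 1" 1] V0 c by (simp add: powr_mult cp)
        also have "\<dots> \<le> V powr (p - 1) * J"
          by (intro mult_left_mono J) auto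
        finally show ?thesis
          using real real2 V p by (simp add: ennpowr_ennreal flip: ennreal_mult)
      qed (use V0 V p in \<open>auto simp: ennpowr_ennreal ennreal_mult_top\<close>)
    next
      case top
      \<comment> \<open>Here the integral of \<open>g\<close> is infinite; as the total mass is
        finite, this bound forces the integral of the p-th power to be infinite too.\<close>
      have "g x \<le> 1 + ennpowr (g x) p" for x
      proof (cases "g x")
        case (real u)
        have "u \<le> 1 + u powr p"
          using powr_mono[of 1 p u] p real by (cases "u \<le> 1") (auto simp: add_increasing2)
        then show ?thesis
          using real p by (simp add: ennpowr_ennreal flip: ennreal_plus ennreal_1)
      qed auto
      then have "(\<integral>\<^sup>+x. g x \<partial>M) \<le> (\<integral>\<^sup>+x. 1 + ennpowr (g x) p \<partial>M)"
        by (intro nn_integral_mono)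
      also have "\<dots> = emeasure M (space M) + (\<integral>\<^sup>+x. ennpowr (g x) p \<partial>M)"
        by (subst nn_integral_add) auto
      finally have "(\<integral>\<^sup>+x. ennpowr (g x) p \<partial>M) = top"
        using top V by (auto simp: top_unique)
      then show ?thesis
        using V0 V p by (simp add: ennpowr_ennreal ennreal_mult_top)
    qed
  qed
qed

text \<open>Jensen's inequality for the measure on the natural numbers with point masses
  \<open>w i\<close>.\<close>

lemma suminf_Jensen:
  assumes p: "p > 1" and fin: "(\<Sum>i. w i) < (top::ennreal)"
  shows "ennpowr (\<Sum>i. w i * f i) p \<le> ennpowr (\<Sum>i. w i) (p - 1) * (\<Sum>i. w i * ennpowr (f i) p)"
proof -
  let ?M = "density (count_space (UNIV::nat set)) w"
  have "emeasure ?M (space ?M) = (\<Sum>i. w i)"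
    by (simp add: emeasure_density nn_integral_count_space_nat)
  then show ?thesis
    using nn_integral_Jensen[OF p, of f ?M] fin
    by (simp add: nn_integral_density nn_integral_count_space_nat)
qed


section \<open>Averages and a discrete Hardy inequality\<close>

text \<open>On a nonseparable metric space the distance can fail to be measurable for the product of
  the Borel sigma-algebras. A countable dense set turns it into a countable infimum of sums of
  functions of one point each.\<close>

lemma borel_measurable_dist_separable:
  fixes D :: "'a::metric_space set" and f g :: "'b \<Rightarrow> 'a"
  assumes D: "countable D" "\<And>x e. e > 0 \<Longrightarrow> \<exists>d\<in>D. dist x d < e"
    and [measurable]: "f \<in> borel_measurable M" "g \<in> borel_measurable M"
  shows "(\<lambda>w. dist (f w) (g w)) \<in> borel_measurable M"
proof -
  have inf: "dist x y = (INF d\<in>D. dist x d + dist d y)" for x y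
  proof (rule antisym)
    have "D \<noteq> {}" using D(2)[of 1] by auto
    then show "dist x y \<le> (INF d\<in>D. dist x d + dist d y)"
      by (intro cINF_greatest dist_triangle)
    show "(INF d\<in>D. dist x d + dist d y) \<le> dist x y"
    proof (rule field_le_epsilon)
      fix e :: real assume "e > 0"
      then obtain d where d: "d \<in> D" "dist x d < e / 2" using D(2)[of "e / 2" x] by auto
      have "(INF d\<in>D. dist x d + dist d y) \<le> dist x d + dist d y"
        by (intro cINF_lower d bdd_belowI2[of _ 0]) auto
      also have "\<dots> \<le> dist x y + e"
        using d dist_triangle[of d y x] by (simp add: dist_commute)
      finally show "(INF d\<in>D. dist x d + dist d y) \<le> dist x y + e" .
    qed
  qed
  have [measurable]: "(\<lambda>x. dist x d) \<in> borel_measurable borel" for d :: 'a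
    by (intro borel_measurable_continuous_onI continuous_intros)
  have "(\<lambda>w. INF d\<in>D. dist (f w) d + dist (g w) d) \<in> borel_measurable M"
    using D(1) by measurable
  then show ?thesis
    by (subst inf) (simp add: dist_commute)
qed

section \<open>Averages over sets of finite measure\<close>

lemma average_diff_le:
  assumes U: "U \<in> sets M" "0 < emeasure M U" "emeasure M U < \<infinity>" and f: "set_integrable M U f"
  shows "ennreal \<bar>c - (LINT y:U|M. f y) / measure M U\<bar> \<le> (1 / emeasure M U) * (\<integral>\<^sup>+y\<in>U. ennreal \<bar>c - f y\<bar> \<partial>M)"
proof -
  let ?V = "measure M U"
  have V: "emeasure M U = ennreal ?V" "?V > 0"
  proof -
    show "emeasure M U = ennreal ?V"
      using U by (intro emeasure_eq_ennreal_measure) auto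
    then show "?V > 0"
      using U by (cases "?V > 0") auto
  qed
  have ci: "set_integrable M U (\<lambda>_. c)"
    using U unfolding set_integrable_def by (auto intro: integrable_real_indicator)
  have "(LINT y:U|M. c - f y) = c * ?V - (LINT y:U|M. f y)"
    unfolding set_integral_diff(2)[OF ci f] using U(1,3)
    by (simp add: set_lebesgue_integral_def mult.commute)
  then have "c - (LINT y:U|M. f y) / ?V = (LINT y:U|M. c - f y) / ?V"
    using V by (simp add: field_simps)
  then have "ennreal \<bar>c - (LINT y:U|M. f y) / ?V\<bar> = ennreal (1 / ?V) * ennreal (norm (LINT y:U|M. c - f y))"
    using V by (simp flip: ennreal_mult)
  also have "\<dots> \<le> ennreal (1 / ?V) * (\<integral>\<^sup>+y. norm (indicator U y *\<^sub>R (c - f y)) \<partial>M)"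
    using set_integral_diff(1)[OF ci f] unfolding set_lebesgue_integral_def set_integrable_def
    by (intro mult_left_mono integral_norm_bound_ennreal) auto
  also have "(\<integral>\<^sup>+y. norm (indicator U y *\<^sub>R (c - f y)) \<partial>M) = (\<integral>\<^sup>+y\<in>U. ennreal \<bar>c - f y\<bar> \<partial>M)"
    by (intro nn_integral_cong) (auto split: split_indicator)
  also have "ennreal (1 / ?V) = 1 / emeasure M U"
    using V divide_ennreal[of 1 ?V] by simp
  finally show ?thesis .
qed

lemma set_nn_integral_Jensen:
  assumes p: "p > 1" and [measurable]: "U \<in> sets M" "g \<in> borel_measurable M" and fin: "emeasure M U < \<infinity>"
  shows "ennpowr (\<integral>\<^sup>+x\<in>U. g x \<partial>M) p \<le> ennpowr (emeasure M U) (p - 1) * (\<integral>\<^sup>+x\<in>U. ennpowr (g x) p \<partial>M)"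
  using nn_integral_Jensen[OF p, of g "density M (indicator U)"] fin
  by (simp add: nn_integral_density emeasure_density mult.commute)

text \<open>With V the mass of \<open>U\<close>, Jensen's inequality costs V to the power p - 1,
  which together with V to the power -p from the mean leaves 1 / V.\<close>

lemma average_diff_powr_le:
  assumes p: "p > 1" and U: "U \<in> sets M" "0 < emeasure M U" "emeasure M U < \<infinity>"
    and f: "set_integrable M U f" and [measurable]: "f \<in> borel_measurable M"
  shows "ennreal (\<bar>c - (LINT y:U|M. f y) / measure M U\<bar> powr p) \<le>
    (1 / emeasure M U) * (\<integral>\<^sup>+y\<in>U. ennreal (\<bar>c - f y\<bar> powr p) \<partial>M)"
proof -
  have [measurable]: "U \<in> sets M" by fact
  let ?V = "measure M U"
  have V: "emeasure M U = ennreal ?V" "?V > 0"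
  proof -
    show "emeasure M U = ennreal ?V"
      using U by (intro emeasure_eq_ennreal_measure) auto
    then show "?V > 0"
      using U by (cases "?V > 0") auto
  qed
  have iV: "1 / emeasure M U = ennreal (1 / ?V)"
    using V divide_ennreal[of 1 ?V] by simp
  have "ennreal (\<bar>c - (LINT y:U|M. f y) / ?V\<bar> powr p) = ennpowr (ennreal \<bar>c - (LINT y:U|M. f y) / ?V\<bar>) p"
    using p by (simp add: ennpowr_ennreal)
  also have "\<dots> \<le> ennpowr (ennreal (1 / ?V) * (\<integral>\<^sup>+y\<in>U. ennreal \<bar>c - f y\<bar> \<partial>M)) p"
    using p average_diff_le[OF U f, of c] unfolding iV by (intro ennpowr_mono) auto
  also have "\<dots> = ennreal ((1 / ?V) powr p) * ennpowr (\<integral>\<^sup>+y\<in>U. ennreal \<bar>c - f y\<bar> \<partial>M) p"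
    using p V by (simp add: ennpowr_mult ennpowr_ennreal)
  also have "\<dots> \<le> ennreal ((1 / ?V) powr p) * (ennpowr (emeasure M U) (p - 1) *
      (\<integral>\<^sup>+y\<in>U. ennpowr (ennreal \<bar>c - f y\<bar>) p \<partial>M))"
    using U p by (intro mult_left_mono set_nn_integral_Jensen) auto
  also have "\<dots> = ennreal ((1 / ?V) powr p * ?V powr (p - 1)) *
      (\<integral>\<^sup>+y\<in>U. ennreal (\<bar>c - f y\<bar> powr p) \<partial>M)"
    using V p by (simp add: ennpowr_ennreal ennreal_mult mult.assoc)
  also have "(1 / ?V) powr p * ?V powr (p - 1) = 1 / ?V"
    using V by (simp add: powr_divide powr_diff)
  finally show ?thesis by (simp add: iV)
qed

text \<open>\<open>\<bar>f x\<bar>\<close> is at most \<open>1 + \<bar>f x\<bar> powr p\<close>, and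
  the constant 1 is integrable over a set of finite measure.\<close>

lemma lp_imp_set_integrable:
  assumes p: "p > 1" and [measurable]: "f \<in> borel_measurable M" "U \<in> sets M"
    and fin: "(\<integral>\<^sup>+x. ennreal (\<bar>f x\<bar> powr p) \<partial>M) < \<infinity>" and U: "emeasure M U < \<infinity>"
  shows "set_integrable M U f"
  unfolding set_integrable_def
proof (rule integrableI_bounded)
  have *: "\<bar>f x\<bar> \<le> 1 + \<bar>f x\<bar> powr p" for x
    using powr_mono[of 1 p "\<bar>f x\<bar>"] p by (cases "\<bar>f x\<bar> \<le> 1") (auto simp: add_increasing2)
  have "(\<integral>\<^sup>+x. ennreal (norm (indicator U x *\<^sub>R f x)) \<partial>M) \<le> (\<integral>\<^sup>+x. indicator U x + ennreal (\<bar>f x\<bar> powr p) \<partial>M)"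
    using * by (intro nn_integral_mono) (auto split: split_indicator simp flip: ennreal_plus ennreal_1)
  also have "\<dots> = emeasure M U + (\<integral>\<^sup>+x. ennreal (\<bar>f x\<bar> powr p) \<partial>M)"
    by (subst nn_integral_add) auto
  finally show "(\<integral>\<^sup>+x. ennreal (norm (indicator U x *\<^sub>R f x)) \<partial>M) < \<infinity>"
    using fin U by (auto intro: le_less_trans simp: ennreal_add_less_top)
qed measurable

text \<open>The increments telescope. The first bound covers divergent sequences as well, where
  \<open>lim\<close> has an unspecified value: the sum of the increments is then infinite.\<close>

lemma lim_diff_le_suminf:
  fixes a :: "nat \<Rightarrow> real"
  shows "ennreal \<bar>lim a - a k\<bar> \<le> (\<Sum>i. ennreal \<bar>a (k + i + 1) - a (k + i)\<bar>)"
    and "(\<Sum>i. ennreal \<bar>a (i + 1) - a i\<bar>) < \<infinity> \<Longrightarrow> convergent a"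
proof -
  have conv: "convergent a \<and> ennreal \<bar>lim a - a k\<bar> \<le> (\<Sum>i. ennreal \<bar>a (k + i + 1) - a (k + i)\<bar>)"
    if fin: "(\<Sum>i. ennreal \<bar>a (k + i + 1) - a (k + i)\<bar>) < \<infinity>" for k
  proof -
    let ?d = "\<lambda>i. a (k + i + 1) - a (k + i)"
    have sm: "summable (\<lambda>i. \<bar>?d i\<bar>)"
      using fin by (intro summable_suminf_not_top) auto
    then have "summable ?d" by (rule summable_rabs_cancel)
    then have "(\<lambda>n. \<Sum>i<n. ?d i) \<longlonglongrightarrow> suminf ?d"
      by (rule summable_LIMSEQ)
    moreover have "(\<Sum>i<n. ?d i) = a (k + n) - a k" for n
      by (induction n) (auto simp: algebra_simps)
    ultimately have "(\<lambda>n. (a (k + n) - a k) + a k) \<longlonglongrightarrow> suminf ?d + a k"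
      by (intro tendsto_intros) auto
    then have "(\<lambda>n. a (n + k)) \<longlonglongrightarrow> suminf ?d + a k"
      by (simp add: add.commute)
    then have L: "a \<longlonglongrightarrow> suminf ?d + a k"
      by (rule LIMSEQ_offset)
    then have "\<bar>lim a - a k\<bar> = \<bar>suminf ?d\<bar>" by (simp add: limI)
    also have "\<dots> \<le> (\<Sum>i. \<bar>?d i\<bar>)" by (rule summable_rabs[OF sm])
    finally have "ennreal \<bar>lim a - a k\<bar> \<le> ennreal (\<Sum>i. \<bar>?d i\<bar>)" by (rule ennreal_leI)
    also have "\<dots> = (\<Sum>i. ennreal \<bar>?d i\<bar>)"
      using sm by (intro suminf_ennreal2[symmetric]) auto
    finally show ?thesis using L by (auto simp: convergent_def)
  qed
  show "ennreal \<bar>lim a - a k\<bar> \<le> (\<Sum>i. ennreal \<bar>a (k + i + 1) - a (k + i)\<bar>)"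
    using conv[of k] by (metis infinity_ennreal_def top.not_eq_extremum top_greatest)
  show "(\<Sum>i. ennreal \<bar>a (i + 1) - a i\<bar>) < \<infinity> \<Longrightarrow> convergent a"
    using conv[of 0] by simp
qed

section \<open>Geometric weights and the discrete Hardy inequality\<close>

lemma suminf_ennreal_geometric:
  assumes "0 < \<rho>" "\<rho> < (1::real)"
  shows "(\<Sum>i. ennreal (\<rho> ^ i)) = ennreal (1 / (1 - \<rho>))"
proof -
  have "(\<Sum>i. ennreal (\<rho> ^ i)) = ennreal (\<Sum>i. \<rho> ^ i)"
    by (rule suminf_ennreal2) (use assms in \<open>auto intro: summable_geometric\<close>)
  also have "(\<Sum>i. \<rho> ^ i) = 1 / (1 - \<rho>)"
    by (rule suminf_geometric) (use assms in simp)
  finally show ?thesis .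
qed

text \<open>After an exchange of the sums, the shift by \<open>i\<close> only drops the first
  \<open>i\<close> terms of \<open>b\<close>, and the weights add up to
  \<open>1 / (1 - \<rho>)\<close>.\<close>

lemma suminf_geometric_shift:
  fixes b :: "nat \<Rightarrow> ennreal"
  assumes \<rho>: "0 < \<rho>" "\<rho> < (1::real)"
  shows "(\<Sum>k. \<Sum>i. ennreal (\<rho> ^ i) * b (k + i)) \<le> ennreal (1 / (1 - \<rho>)) * (\<Sum>k. b k)"
proof -
  have "(\<Sum>k. \<Sum>i. ennreal (\<rho> ^ i) * b (k + i)) = (\<Sum>i. \<Sum>k. ennreal (\<rho> ^ i) * b (k + i))"
    using nn_integral_suminf[of "\<lambda>i k. ennreal (\<rho> ^ i) * b (k + i)" "count_space (UNIV :: nat set)"]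
    by (simp add: nn_integral_count_space_nat)
  also have "\<dots> \<le> (\<Sum>i. ennreal (\<rho> ^ i) * (\<Sum>k. b k))"
  proof (intro suminf_le summableI)
    fix i
    have "(\<Sum>k. b (k + i)) \<le> (\<Sum>k. b k)"
      using suminf_offset[of b i] by (simp add: summableI)
    then show "(\<Sum>k. ennreal (\<rho> ^ i) * b (k + i)) \<le> ennreal (\<rho> ^ i) * (\<Sum>k. b k)"
      by (simp add: mult_left_mono)
  qed
  also have "\<dots> = (\<Sum>i. ennreal (\<rho> ^ i)) * (\<Sum>k. b k)"
    by simp
  also have "(\<Sum>i. ennreal (\<rho> ^ i)) = ennreal (1 / (1 - \<rho>))"
    by (rule suminf_ennreal_geometric[OF \<rho>])
  finally show ?thesis .
qed

text \<open>Applied with \<open>r = q / p\<close>, where both ranges occur. For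
  \<open>r \<le> 1\<close>, subadditivity of the power leads to shifted sums with ratio
  \<open>\<rho> powr r\<close>; for \<open>r > 1\<close>, Jensen's inequality with weights
  \<open>\<rho> ^ i\<close> keeps the ratio \<open>\<rho>\<close>.\<close>

lemma hardy_geometric:
  fixes \<rho> r :: real
  assumes \<rho>: "0 < \<rho>" "\<rho> < 1" and r: "r > 0"
  obtains C :: real where "C > 0"
    "\<And>b :: nat \<Rightarrow> ennreal. (\<Sum>k. ennpowr (\<Sum>i. ennreal (\<rho> ^ i) * b (k + i)) r) \<le> ennreal C * (\<Sum>k. ennpowr (b k) r)"
proof (cases "r \<le> 1")
  case True
  have pr: "(\<rho> ^ i) powr r = (\<rho> powr r) ^ i" for i
    using \<rho> by (simp add: powr_powr mult.commute flip: powr_realpow)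
  have lt: "\<rho> powr r < 1"
    using \<rho> r powr_less_mono2[of r \<rho> 1] by simp
  show ?thesis
  proof (rule that)
    show "1 / (1 - \<rho> powr r) > 0" using lt by simp
    fix b :: "nat \<Rightarrow> ennreal"
    have "(\<Sum>k. ennpowr (\<Sum>i. ennreal (\<rho> ^ i) * b (k + i)) r) \<le> (\<Sum>k. \<Sum>i. ennpowr (ennreal (\<rho> ^ i) * b (k + i)) r)"
      by (intro suminf_le summableI ennpowr_suminf_le r True)
    also have "\<dots> = (\<Sum>k. \<Sum>i. ennreal ((\<rho> powr r) ^ i) * ennpowr (b (k + i)) r)"
      using r \<rho> by (simp add: ennpowr_mult ennpowr_ennreal pr)
    also have "\<dots> \<le> ennreal (1 / (1 - \<rho> powr r)) * (\<Sum>k. ennpowr (b k) r)"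
      using lt \<rho> by (intro suminf_geometric_shift) auto
    finally show "(\<Sum>k. ennpowr (\<Sum>i. ennreal (\<rho> ^ i) * b (k + i)) r) \<le> ennreal (1 / (1 - \<rho> powr r)) * (\<Sum>k. ennpowr (b k) r)" .
  qed
next
  case False
  then have r1: "r > 1" by simp
  note gs = suminf_ennreal_geometric[OF \<rho>]
  let ?C = "(1 / (1 - \<rho>)) powr (r - 1)"
  show ?thesis
  proof (rule that)
    show "?C * (1 / (1 - \<rho>)) > 0" using \<rho> by simp
    fix b :: "nat \<Rightarrow> ennreal"
    have "(\<Sum>k. ennpowr (\<Sum>i. ennreal (\<rho> ^ i) * b (k + i)) r) \<le>
        (\<Sum>k. ennreal ?C * (\<Sum>i. ennreal (\<rho> ^ i) * ennpowr (b (k + i)) r))"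
    proof (intro suminf_le summableI)
      fix k
      show "ennpowr (\<Sum>i. ennreal (\<rho> ^ i) * b (k + i)) r \<le> ennreal ?C * (\<Sum>i. ennreal (\<rho> ^ i) * ennpowr (b (k + i)) r)"
        using suminf_Jensen[OF r1, of "\<lambda>i. ennreal (\<rho> ^ i)" "\<lambda>i. b (k + i)"] \<rho> r1
        by (simp add: gs ennpowr_ennreal)
    qed
    also have "\<dots> = ennreal ?C * (\<Sum>k. \<Sum>i. ennreal (\<rho> ^ i) * ennpowr (b (k + i)) r)"
      by simp
    also have "\<dots> \<le> ennreal ?C * (ennreal (1 / (1 - \<rho>)) * (\<Sum>k. ennpowr (b k) r))"
      using \<rho> by (intro mult_left_mono suminf_geometric_shift) auto
    also have "\<dots> = ennreal (?C * (1 / (1 - \<rho>))) * (\<Sum>k. ennpowr (b k) r)"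
      using \<rho> by (subst ennreal_mult) (auto simp: mult.assoc)
    finally show "(\<Sum>k. ennpowr (\<Sum>i. ennreal (\<rho> ^ i) * b (k + i)) r) \<le>
        ennreal (?C * (1 / (1 - \<rho>))) * (\<Sum>k. ennpowr (b k) r)" .
  qed
qed


section \<open>Averages over balls of the large space, seen from the small one\<close>

lemma ennreal_divide_antimono: "b \<le> c \<Longrightarrow> a / c \<le> (a / b :: ennreal)"
proof -
  assume "b \<le> c"
  then have "inverse c \<le> inverse b"
    by (cases b; cases c; cases "b = 0"; cases "c = 0") (auto simp: inverse_ennreal top_unique intro!: ennreal_leI le_imp_inverse_le)
  then show ?thesis
    unfolding divide_ennreal_def by (intro mult_left_mono) auto
qed

text \<open>Two applications of Tonelli move the outer integral to the innermost place. Later this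
  lets the \<mu>-integral be carried out first, for fixed points \<open>y\<close> and
  \<open>z\<close> of the large space.\<close>

lemma nn_integral_swap3:
  assumes "sigma_finite_measure A" "sigma_finite_measure B" "sigma_finite_measure C"
    and [measurable]: "(\<lambda>(x, y, z). k x y z) \<in> borel_measurable (A \<Otimes>\<^sub>M B \<Otimes>\<^sub>M C)"
  shows "(\<integral>\<^sup>+x. \<integral>\<^sup>+y. \<integral>\<^sup>+z. k x y z \<partial>C \<partial>B \<partial>A) = (\<integral>\<^sup>+y. \<integral>\<^sup>+z. \<integral>\<^sup>+x. k x y z \<partial>A \<partial>C \<partial>B)"
proof -
  have BA: "pair_sigma_finite B A" and CA: "pair_sigma_finite C A"
    using assms by (auto simp: pair_sigma_finite_def)
  have "(\<integral>\<^sup>+x. \<integral>\<^sup>+y. \<integral>\<^sup>+z. k x y z \<partial>C \<partial>B \<partial>A) = (\<integral>\<^sup>+y. \<integral>\<^sup>+x. \<integral>\<^sup>+z. k x y z \<partial>C \<partial>A \<partial>B)"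
  proof (rule pair_sigma_finite.Fubini'[OF BA])
    have [measurable]: "(\<lambda>w. k (snd (fst w)) (fst (fst w)) (snd w)) \<in> borel_measurable ((B \<Otimes>\<^sub>M A) \<Otimes>\<^sub>M C)"
    proof -
      have "(\<lambda>w. (snd (fst w), fst (fst w), snd w)) \<in> measurable ((B \<Otimes>\<^sub>M A) \<Otimes>\<^sub>M C) (A \<Otimes>\<^sub>M B \<Otimes>\<^sub>M C)"
        by measurable
      from measurable_compose[OF this assms(4)] show ?thesis
        by (simp add: split_beta')
    qed
    show "(\<lambda>(y, x). \<integral>\<^sup>+z. k x y z \<partial>C) \<in> borel_measurable (B \<Otimes>\<^sub>M A)"
      using sigma_finite_measure.borel_measurable_nn_integral[OF assms(3), of "\<lambda>w z. k (snd w) (fst w) z" "B \<Otimes>\<^sub>M A"]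
      by (simp add: split_beta')
  qed
  also have "\<dots> = (\<integral>\<^sup>+y. \<integral>\<^sup>+z. \<integral>\<^sup>+x. k x y z \<partial>A \<partial>C \<partial>B)"
  proof (intro nn_integral_cong pair_sigma_finite.Fubini'[OF CA])
    fix y assume "y \<in> space B"
    then show "(\<lambda>(z, x). k x y z) \<in> borel_measurable (C \<Otimes>\<^sub>M A)"
      using measurable_compose[OF _ assms(4), of "\<lambda>(z, x). (x, y, z)" "C \<Otimes>\<^sub>M A"]
      by (simp add: split_beta')
  qed
  finally show ?thesis .
qed

text \<open>The indicator of a ball as a function of both points: it is symmetric, and jointly
  measurable as soon as the distance is.\<close>

definition near :: "real \<Rightarrow> 'a::metric_space \<Rightarrow> 'a \<Rightarrow> ennreal" where
  "near t x y = (if dist x y < t then 1 else 0)"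

lemma near_eq: "near t x = indicator (ball x t)"
  by (auto simp: near_def fun_eq_iff split: split_indicator)

lemma near_commute: "near t x y = near t y x"
  by (simp add: near_def dist_commute)

definition avg :: "'a::metric_space measure \<Rightarrow> real \<Rightarrow> ('a \<Rightarrow> real) \<Rightarrow> 'a \<Rightarrow> real" where
  "avg m r f x = (LINT y:ball x r|m. f y) / measure m (ball x r)"

text \<open>When balls of radius \<open>t\<close> have mass comparable to \<open>t powr N\<close>,
  this is comparable to \<open>t powr N\<close> times the p-th power of
  \<open>besov_E p m f t\<close>. Leaving out the normalisation makes it monotone in
  \<open>t\<close>.\<close>

definition lp_diff :: "real \<Rightarrow> 'a::metric_space measure \<Rightarrow> ('a \<Rightarrow> real) \<Rightarrow> real \<Rightarrow> ennreal" where
  "lp_diff p m f t = (\<integral>\<^sup>+y. \<integral>\<^sup>+z. near t y z * ennreal (\<bar>f y - f z\<bar> powr p) \<partial>m \<partial>m)"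

lemma lp_diff_mono: "s \<le> t \<Longrightarrow> lp_diff p m f s \<le> lp_diff p m f t"
  unfolding lp_diff_def by (intro nn_integral_mono mult_right_mono) (auto simp: near_def)

text \<open>Both measures live on the whole type, with \<mu> carried by \<open>F\<close>. The upper
  bound for \<mu> is stated for all centres because it is applied at points of the large space.
  Since \<open>F\<close> may be bounded, the lower bound stops at radius 1, and
  \<open>\<mu>_doubling\<close> takes over beyond. The dense set \<open>D\<close> serves joint
  measurability.\<close>

locale trace_setting =
  fixes m \<mu> :: "'a::metric_space measure" and F D :: "'a set" and N \<delta> C K L E p \<alpha> \<beta> :: real
  assumes sets_m [measurable_cong]: "sets m = sets borel"
    and sets_\<mu> [measurable_cong]: "sets \<mu> = sets borel"
    and D: "countable D" "\<And>x e. e > 0 \<Longrightarrow> \<exists>d\<in>D. dist x d < e"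
    and pos: "C > 0" "K > 0" "L > 0" "E > 0"
    and m_upper: "r > 0 \<Longrightarrow> emeasure m (ball x r) \<le> ennreal (C * r powr N)"
    and m_lower: "r > 0 \<Longrightarrow> ennreal (r powr N / C) \<le> emeasure m (ball x r)"
    and \<mu>_upper: "r > 0 \<Longrightarrow> emeasure \<mu> (ball x r) \<le> ennreal (K * r powr \<delta>)"
    and \<mu>_lower: "x \<in> F \<Longrightarrow> 0 < r \<Longrightarrow> r \<le> 1 \<Longrightarrow> ennreal (r powr \<delta> / L) \<le> emeasure \<mu> (ball x r)"
    and \<mu>_doubling: "x \<in> F \<Longrightarrow> y \<in> F \<Longrightarrow> dist x y < r \<Longrightarrow>
      emeasure \<mu> (ball y r) \<le> ennreal E * emeasure \<mu> (ball x r)"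
    and F: "AE x in \<mu>. x \<in> F"
    and p: "p > 1" and \<beta>: "\<beta> > 0" "\<beta> = \<alpha> - (N - \<delta>) / p"
begin

section \<open>Sigma-finiteness and joint measurability\<close>

lemma space_eq_UNIV [simp]: "space m = UNIV" "space \<mu> = UNIV"
  using sets_eq_imp_space_eq[OF sets_m] sets_eq_imp_space_eq[OF sets_\<mu>] by auto

lemma ball_sets [measurable]: "ball x r \<in> sets m" "ball x r \<in> sets \<mu>"
  by (simp_all add: sets_m sets_\<mu>)

lemma sigma_finite_balls:
  assumes "sets M = sets borel" "\<And>r x. r > 0 \<Longrightarrow> emeasure M (ball (x::'a) r) < \<infinity>"
  shows "sigma_finite_measure M"
proof (unfold_locales, intro exI conjI)
  let ?A = "range (\<lambda>n::nat. ball (undefined::'a) (real n + 1))"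
  show "countable ?A" "?A \<subseteq> sets M" "\<forall>a\<in>?A. emeasure M a \<noteq> \<infinity>"
    using assms by (auto simp: top.not_eq_extremum)
  have "\<exists>n::nat. x \<in> ball undefined (real n + 1)" for x :: 'a
    using reals_Archimedean2[of "dist undefined x"] by (auto intro: less_trans[OF _ less_add_one])
  then show "\<Union> ?A = space M"
    using sets_eq_imp_space_eq[OF assms(1)] by auto
qed

lemma m_ball_less_top [simp]: "emeasure m (ball x r) < top"
  using m_upper[of r x] by (cases "r > 0") (auto intro: le_less_trans simp: ball_empty)

lemma \<mu>_ball_less_top [simp]: "emeasure \<mu> (ball x r) < top"
  using \<mu>_upper[of r x] by (cases "r > 0") (auto intro: le_less_trans simp: ball_empty)

lemma m_ball_pos: "r > 0 \<Longrightarrow> 0 < emeasure m (ball x r)"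
  using m_lower[of r x] pos by (auto intro: less_le_trans[rotated])

lemma \<mu>_ball_pos:
  assumes "r > 0" "x \<in> F" shows "0 < emeasure \<mu> (ball x r)"
proof -
  have "0 < ennreal (min r 1 powr \<delta> / L)" using assms pos by simp
  also have "\<dots> \<le> emeasure \<mu> (ball x (min r 1))" using assms by (intro \<mu>_lower) auto
  also have "\<dots> \<le> emeasure \<mu> (ball x r)" by (intro emeasure_mono) auto
  finally show ?thesis .
qed

lemma sigma_finite: "sigma_finite_measure m" "sigma_finite_measure \<mu>"
  by (rule sigma_finite_balls; auto simp: sets_m sets_\<mu>)+

lemma pair_sigma_finite: "pair_sigma_finite \<mu> m" "pair_sigma_finite \<mu> \<mu>"
  by (simp_all add: pair_sigma_finite_def sigma_finite)

lemmas [measurable (raw)] =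
  sigma_finite_measure.borel_measurable_nn_integral[OF sigma_finite(1)]
  sigma_finite_measure.borel_measurable_nn_integral[OF sigma_finite(2)]
  sigma_finite_measure.borel_measurable_lebesgue_integral[OF sigma_finite(1)]

lemma measurable_dist' [measurable]:
  "f \<in> measurable M borel \<Longrightarrow> g \<in> measurable M borel \<Longrightarrow> (\<lambda>w. dist (f w) (g w :: 'a)) \<in> borel_measurable M"
  by (rule borel_measurable_dist_separable[OF D])

lemma measurable_near [measurable]:
  assumes [measurable]: "f \<in> measurable M borel" "g \<in> measurable M borel"
  shows "(\<lambda>w. near t (f w) (g w :: 'a)) \<in> borel_measurable M"
  unfolding near_def by measurable

lemma nn_integral_near [simp]:
  "(\<integral>\<^sup>+y. near t x y \<partial>m) = emeasure m (ball x t)" "(\<integral>\<^sup>+y. near t x y \<partial>\<mu>) = emeasure \<mu> (ball x t)"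
  by (simp_all add: near_eq)

lemma measurable_emeasure_ball [measurable]:
  assumes [measurable]: "f \<in> measurable M borel"
  shows "(\<lambda>w. emeasure m (ball (f w) t)) \<in> borel_measurable M" "(\<lambda>w. emeasure \<mu> (ball (f w) t)) \<in> borel_measurable M"
  by (simp_all flip: nn_integral_near) measurable

lemma measurable_avg [measurable]:
  assumes [measurable]: "f \<in> borel_measurable borel"
  shows "avg m r f \<in> borel_measurable borel"
proof -
  \<comment> \<open>Written with \<open>dist\<close> in place of a ball depending on
    \<open>x\<close>, the integrand is jointly measurable in both points.\<close>
  have "avg m r f = (\<lambda>x. (\<integral>y. (if dist x y < r then f y else 0) \<partial>m) / enn2real (emeasure m (ball x r)))"
    by (auto simp: avg_def fun_eq_iff set_lebesgue_integral_def measure_def intro!: Bochner_Integration.integral_cong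
      arg_cong2[of _ _ _ _ "(/)"])
  then show ?thesis by simp
qed

definition Lp :: "('a \<Rightarrow> real) set" where
  "Lp = {f \<in> borel_measurable borel. (\<integral>\<^sup>+x. ennreal (\<bar>f x\<bar> powr p) \<partial>m) < \<infinity>}"

lemma Lp_measurable [measurable_dest]: "f \<in> Lp \<Longrightarrow> f \<in> borel_measurable borel"
  by (simp add: Lp_def)

lemma Lp_set_integrable: "f \<in> Lp \<Longrightarrow> set_integrable m (ball x r) f"
  by (intro lp_imp_set_integrable[OF p]) (auto simp: Lp_def measurable_cong_sets[OF sets_m refl])

section \<open>Averages compared with values and with each other\<close>

lemma inverse_m_ball: "r > 0 \<Longrightarrow> 1 / emeasure m (ball x r) \<le> ennreal (C * r powr - N)"
proof -
  assume r: "r > 0"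
  have "1 / emeasure m (ball x r) \<le> 1 / ennreal (r powr N / C)"
    using r pos m_lower[of r x] by (intro ennreal_divide_antimono)
  also have "\<dots> = ennreal (C * r powr - N)"
    using r pos divide_ennreal[of 1 "r powr N / C"] by (simp add: powr_minus field_simps)
  finally show ?thesis .
qed

lemma avg_diff_powr_le:
  assumes f: "f \<in> Lp" and r: "r > 0"
  shows "ennreal (\<bar>c - avg m r f x\<bar> powr p) \<le> ennreal (C * r powr - N) * (\<integral>\<^sup>+y. near r x y * ennreal (\<bar>c - f y\<bar> powr p) \<partial>m)"
proof -
  have [measurable]: "f \<in> borel_measurable m" using f by (simp add: Lp_def measurable_cong_sets[OF sets_m refl])
  have "ennreal (\<bar>c - avg m r f x\<bar> powr p) \<le> (1 / emeasure m (ball x r)) * (\<integral>\<^sup>+y\<in>ball x r. ennreal (\<bar>c - f y\<bar> powr p) \<partial>m)"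
    unfolding avg_def using f r
    by (intro average_diff_powr_le p Lp_set_integrable) (auto simp: m_ball_pos)
  also have "\<dots> \<le> ennreal (C * r powr - N) * (\<integral>\<^sup>+y. near r x y * ennreal (\<bar>c - f y\<bar> powr p) \<partial>m)"
    using r by (intro mult_mono inverse_m_ball) (auto simp: near_eq mult.commute)
  finally show ?thesis .
qed

text \<open>The bound for a fixed number is used twice: first for \<open>avg m s f x'\<close>, then
  for \<open>f y\<close> with each \<open>y\<close>. Centres and radii may both differ, which serves
  the change of scale as well as the change of point.\<close>

lemma avg_avg_diff_powr_le:
  assumes f: "f \<in> Lp" and r: "r > 0" "s > 0"
  shows "ennreal (\<bar>avg m r f x - avg m s f x'\<bar> powr p) \<le> ennreal (C\<^sup>2 * (r powr - N * s powr - N)) *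
    (\<integral>\<^sup>+y. \<integral>\<^sup>+z. near r x y * near s x' z * ennreal (\<bar>f y - f z\<bar> powr p) \<partial>m \<partial>m)"
proof -
  note [measurable] = Lp_measurable[OF f]
  let ?c = "avg m s f x'"
  have "ennreal (\<bar>avg m r f x - ?c\<bar> powr p) \<le> ennreal (C * r powr - N) * (\<integral>\<^sup>+y. near r x y * ennreal (\<bar>f y - ?c\<bar> powr p) \<partial>m)"
    using avg_diff_powr_le[OF f r(1), of ?c x] by (simp add: abs_minus_commute)
  also have "\<dots> \<le> ennreal (C * r powr - N) * (\<integral>\<^sup>+y. near r x y * (ennreal (C * s powr - N) *
      (\<integral>\<^sup>+z. near s x' z * ennreal (\<bar>f y - f z\<bar> powr p) \<partial>m)) \<partial>m)"
    by (intro mult_left_mono nn_integral_mono avg_diff_powr_le f r) auto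
  also have "\<dots> = ennreal (C * r powr - N) * ennreal (C * s powr - N) *
      (\<integral>\<^sup>+y. near r x y * (\<integral>\<^sup>+z. near s x' z * ennreal (\<bar>f y - f z\<bar> powr p) \<partial>m) \<partial>m)"
    by (simp add: nn_integral_cmult mult.left_commute[of _ "ennreal (C * s powr - N)"] mult.assoc)
  also have "ennreal (C * r powr - N) * ennreal (C * s powr - N) = ennreal (C\<^sup>2 * (r powr - N * s powr - N))"
    using pos by (simp add: power2_eq_square mult_ac flip: ennreal_mult)
  also have "(\<integral>\<^sup>+y. near r x y * (\<integral>\<^sup>+z. near s x' z * ennreal (\<bar>f y - f z\<bar> powr p) \<partial>m) \<partial>m) =
    (\<integral>\<^sup>+y. \<integral>\<^sup>+z. near r x y * near s x' z * ennreal (\<bar>f y - f z\<bar> powr p) \<partial>m \<partial>m)"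
    by (simp add: nn_integral_cmult mult.assoc)
  finally show ?thesis .
qed

text \<open>With \<open>y\<close> and \<open>z\<close> fixed, only points \<open>x\<close> within
  \<open>r\<close> of \<open>y\<close> count, a set of \<mu>-mass at most
  \<open>K * r powr \<delta>\<close>. That \<open>x\<close> is also within \<open>s\<close> of
  \<open>z\<close> is kept only through \<open>dist y z < r + s\<close>.\<close>

lemma nn_integral_avg_radii_le:
  assumes f: "f \<in> Lp" and r: "r > 0" "s > 0"
  shows "(\<integral>\<^sup>+x. ennreal (\<bar>avg m r f x - avg m s f x\<bar> powr p) \<partial>\<mu>) \<le>
    ennreal (C\<^sup>2 * K * (r powr (\<delta> - N) * s powr - N)) * lp_diff p m f (r + s)"
proof -
  note [measurable] = Lp_measurable[OF f]
  let ?h = "\<lambda>y z. ennreal (\<bar>f y - f z\<bar> powr p)"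
  let ?c = "C\<^sup>2 * (r powr - N * s powr - N)"
  have c: "?c \<ge> 0" by simp
  have "(\<integral>\<^sup>+x. ennreal (\<bar>avg m r f x - avg m s f x\<bar> powr p) \<partial>\<mu>) \<le>
      (\<integral>\<^sup>+x. ennreal ?c * (\<integral>\<^sup>+y. \<integral>\<^sup>+z. near r x y * near s x z * ?h y z \<partial>m \<partial>m) \<partial>\<mu>)"
    by (intro nn_integral_mono avg_avg_diff_powr_le f r)
  also have "\<dots> = ennreal ?c * (\<integral>\<^sup>+x. \<integral>\<^sup>+y. \<integral>\<^sup>+z. near r x y * near s x z * ?h y z \<partial>m \<partial>m \<partial>\<mu>)"
    by (simp add: nn_integral_cmult)
  also have "(\<integral>\<^sup>+x. \<integral>\<^sup>+y. \<integral>\<^sup>+z. near r x y * near s x z * ?h y z \<partial>m \<partial>m \<partial>\<mu>) =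
      (\<integral>\<^sup>+y. \<integral>\<^sup>+z. \<integral>\<^sup>+x. near r x y * near s x z * ?h y z \<partial>\<mu> \<partial>m \<partial>m)"
    by (rule nn_integral_swap3) (auto intro: sigma_finite)
  also have "\<dots> \<le> (\<integral>\<^sup>+y. \<integral>\<^sup>+z. ennreal (K * r powr \<delta>) * (near (r + s) y z * ?h y z) \<partial>m \<partial>m)"
  proof (intro nn_integral_mono)
    fix y z
    have "(\<integral>\<^sup>+x. near r x y * near s x z * ?h y z \<partial>\<mu>) \<le> (\<integral>\<^sup>+x. near r y x * (near (r + s) y z * ?h y z) \<partial>\<mu>)"
    proof (intro nn_integral_mono)
      fix x
      show "near r x y * near s x z * ?h y z \<le> near r y x * (near (r + s) y z * ?h y z)"
        using dist_triangle[of y z x] by (auto simp: near_def dist_commute)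
    qed
    also have "\<dots> = emeasure \<mu> (ball y r) * (near (r + s) y z * ?h y z)"
      by (simp add: nn_integral_multc)
    also have "\<dots> \<le> ennreal (K * r powr \<delta>) * (near (r + s) y z * ?h y z)"
      using r by (intro mult_right_mono \<mu>_upper) auto
    finally show "(\<integral>\<^sup>+x. near r x y * near s x z * ?h y z \<partial>\<mu>) \<le> \<dots>" .
  qed
  also have "\<dots> = ennreal (K * r powr \<delta>) * lp_diff p m f (r + s)"
    by (simp add: nn_integral_cmult lp_diff_def)
  finally have "(\<integral>\<^sup>+x. ennreal (\<bar>avg m r f x - avg m s f x\<bar> powr p) \<partial>\<mu>) \<le>
      ennreal ?c * (ennreal (K * r powr \<delta>) * lp_diff p m f (r + s))"
    using c by (auto simp: mult_left_mono)
  also have "\<dots> = ennreal (?c * (K * r powr \<delta>)) * lp_diff p m f (r + s)"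
    using pos c by (subst ennreal_mult) (auto simp: mult.assoc)
  also have "?c * (K * r powr \<delta>) = C\<^sup>2 * K * (r powr (\<delta> - N) * s powr - N)"
    using r by (simp add: powr_diff powr_minus field_simps)
  finally show ?thesis .
qed

lemma inverse_\<mu>_ball:
  assumes r: "0 < r" "r \<le> 1" and x: "x \<in> F"
  shows "1 / emeasure \<mu> (ball x r) \<le> ennreal (L * r powr - \<delta>)"
proof -
  have "1 / emeasure \<mu> (ball x r) \<le> 1 / ennreal (r powr \<delta> / L)"
    using r x pos \<mu>_lower[of x r] by (intro ennreal_divide_antimono) auto
  also have "\<dots> = ennreal (L * r powr - \<delta>)"
    using r pos divide_ennreal[of 1 "r powr \<delta> / L"] by (simp add: powr_minus field_simps)
  finally show ?thesis .
qed

text \<open>Integrating out \<open>x'\<close> over the ball of radius \<open>t\<close> around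
  \<open>x\<close> yields \<open>K * t powr \<delta>\<close>, which cancels the factor
  \<open>L * t powr - \<delta>\<close> bounding the normalisation; that bound is where
  \<open>t \<le> 1\<close> enters. The integral in \<open>x\<close> over the ball around
  \<open>z\<close> then yields \<open>K * r powr \<delta>\<close>.\<close>

lemma nn_integral_avg_centers_le:
  assumes f: "f \<in> Lp" and r: "r > 0" and t: "0 < t" "t \<le> 1"
  shows "(\<integral>\<^sup>+x. (1 / emeasure \<mu> (ball x t)) * (\<integral>\<^sup>+x'. near t x x' * ennreal (\<bar>avg m r f x' - avg m r f x\<bar> powr p) \<partial>\<mu>) \<partial>\<mu>) \<le>
    ennreal (C\<^sup>2 * K\<^sup>2 * L * r powr (\<delta> - 2 * N)) * lp_diff p m f (2 * r + t)"
proof -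
  note [measurable] = Lp_measurable[OF f]
  let ?h = "\<lambda>y z. ennreal (\<bar>f y - f z\<bar> powr p)"
  let ?c = "C\<^sup>2 * (r powr - N * r powr - N)"
  let ?l = "L * t powr - \<delta>"
  let ?g = "\<lambda>x x' y z. near t x x' * (near r x' y * near r x z * ?h y z)"
  have c: "?c \<ge> 0" "?l \<ge> 0" using pos by auto
  have "(\<integral>\<^sup>+x. (1 / emeasure \<mu> (ball x t)) * (\<integral>\<^sup>+x'. near t x x' * ennreal (\<bar>avg m r f x' - avg m r f x\<bar> powr p) \<partial>\<mu>) \<partial>\<mu>)
    \<le> (\<integral>\<^sup>+x. ennreal ?l * (\<integral>\<^sup>+x'. near t x x' * (ennreal ?c * (\<integral>\<^sup>+y. \<integral>\<^sup>+z. near r x' y * near r x z * ?h y z \<partial>m \<partial>m)) \<partial>\<mu>) \<partial>\<mu>)"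
    using F by (intro nn_integral_mono_AE, eventually_elim)
      (intro mult_mono nn_integral_mono mult_left_mono avg_avg_diff_powr_le inverse_\<mu>_ball f r t; simp)
  also have "\<dots> = ennreal ?l * (ennreal ?c * (\<integral>\<^sup>+x. \<integral>\<^sup>+x'. \<integral>\<^sup>+y. \<integral>\<^sup>+z. ?g x x' y z \<partial>m \<partial>m \<partial>\<mu> \<partial>\<mu>))"
    by (simp add: nn_integral_cmult mult.left_commute[of _ "ennreal ?c"])
  \<comment> \<open>The first exchange, for fixed \<open>x\<close>, brings \<open>x'\<close>
    innermost; the second moves \<open>x\<close> inside the integrals over \<open>y\<close> and
    \<open>z\<close>.\<close>
  also have "(\<integral>\<^sup>+x. \<integral>\<^sup>+x'. \<integral>\<^sup>+y. \<integral>\<^sup>+z. ?g x x' y z \<partial>m \<partial>m \<partial>\<mu> \<partial>\<mu>) =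
      (\<integral>\<^sup>+x. \<integral>\<^sup>+y. \<integral>\<^sup>+z. \<integral>\<^sup>+x'. ?g x x' y z \<partial>\<mu> \<partial>m \<partial>m \<partial>\<mu>)"
    by (intro nn_integral_cong nn_integral_swap3 sigma_finite) measurable
  also have "\<dots> = (\<integral>\<^sup>+y. \<integral>\<^sup>+z. \<integral>\<^sup>+x. \<integral>\<^sup>+x'. ?g x x' y z \<partial>\<mu> \<partial>\<mu> \<partial>m \<partial>m)"
    by (rule nn_integral_swap3[OF sigma_finite(2,1,1)]) measurable
  also have "\<dots> \<le> (\<integral>\<^sup>+y. \<integral>\<^sup>+z. ennreal (K * r powr \<delta> * (K * t powr \<delta>)) * (near (2 * r + t) y z * ?h y z) \<partial>m \<partial>m)"
  proof (intro nn_integral_mono)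
    fix y z
    let ?H = "near (2 * r + t) y z * ?h y z"
    have "(\<integral>\<^sup>+x. \<integral>\<^sup>+x'. ?g x x' y z \<partial>\<mu> \<partial>\<mu>) \<le> (\<integral>\<^sup>+x. \<integral>\<^sup>+x'. near t x x' * (near r z x * ?H) \<partial>\<mu> \<partial>\<mu>)"
    proof (intro nn_integral_mono)
      fix x x'
      \<comment> \<open>The chain from \<open>y\<close> over \<open>x'\<close> and \<open>x\<close>
        to \<open>z\<close> has length less than \<open>r + t + r\<close>.\<close>
      show "?g x x' y z \<le> near t x x' * (near r z x * ?H)"
        using dist_triangle[of y z x] dist_triangle[of y x x'] by (auto simp: near_def dist_commute)
    qed
    also have "\<dots> = (\<integral>\<^sup>+x. emeasure \<mu> (ball x t) * (near r z x * ?H) \<partial>\<mu>)"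
      by (simp add: nn_integral_multc)
    also have "\<dots> \<le> (\<integral>\<^sup>+x. ennreal (K * t powr \<delta>) * (near r z x * ?H) \<partial>\<mu>)"
      using t by (intro nn_integral_mono mult_right_mono \<mu>_upper) auto
    also have "\<dots> = ennreal (K * t powr \<delta>) * (emeasure \<mu> (ball z r) * ?H)"
      by (simp add: nn_integral_multc nn_integral_cmult)
    also have "\<dots> \<le> ennreal (K * t powr \<delta>) * (ennreal (K * r powr \<delta>) * ?H)"
      using r by (intro mult_left_mono mult_right_mono \<mu>_upper) auto
    also have "\<dots> = ennreal (K * r powr \<delta> * (K * t powr \<delta>)) * ?H"
      using pos by (simp add: ennreal_mult mult_ac)
    finally show "(\<integral>\<^sup>+x. \<integral>\<^sup>+x'. ?g x x' y z \<partial>\<mu> \<partial>\<mu>) \<le> ennreal (K * r powr \<delta> * (K * t powr \<delta>)) * ?H" .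
  qed
  also have "\<dots> = ennreal (K * r powr \<delta> * (K * t powr \<delta>)) * lp_diff p m f (2 * r + t)"
    by (simp add: nn_integral_cmult lp_diff_def)
  finally have "(\<integral>\<^sup>+x. (1 / emeasure \<mu> (ball x t)) * (\<integral>\<^sup>+x'. near t x x' * ennreal (\<bar>avg m r f x' - avg m r f x\<bar> powr p) \<partial>\<mu>) \<partial>\<mu>) \<le>
      ennreal ?l * (ennreal ?c * (ennreal (K * r powr \<delta> * (K * t powr \<delta>)) * lp_diff p m f (2 * r + t)))"
    by (auto simp: mult_left_mono)
  also have "\<dots> = ennreal (?l * (?c * (K * r powr \<delta> * (K * t powr \<delta>)))) * lp_diff p m f (2 * r + t)"
    using pos c by (simp add: ennreal_mult mult.assoc)
  also have "?l * (?c * (K * r powr \<delta> * (K * t powr \<delta>))) = C\<^sup>2 * K\<^sup>2 * L * r powr (\<delta> - 2 * N)"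
    using r t powr_add[of r N N] by (simp add: powr_diff powr_minus field_simps power2_eq_square)
  finally show ?thesis .
qed

end


section \<open>The trace operator\<close>

text \<open>Dyadic radii make this the limit of a sequence of measurable functions. Where the
  averages diverge, \<open>lim\<close> is unspecified, so linearity is proved only almost
  everywhere.\<close>

definition trace_op :: "'a::metric_space measure \<Rightarrow> ('a \<Rightarrow> real) \<Rightarrow> 'a \<Rightarrow> real" where
  "trace_op m f x = lim (\<lambda>k. avg m ((1 / 2) ^ k) f x)"

text \<open>The sum of the three differences is at most three times their maximum, rounded up to 4
  times; the p-th power of the maximum is at most the sum of the p-th powers.\<close>

lemma powr_add3_le:
  assumes "p > (0::real)"
  shows "ennreal (\<bar>a - d\<bar> powr p) \<le> ennreal (4 powr p) *
    (ennreal (\<bar>a - b\<bar> powr p) + ennreal (\<bar>b - c\<bar> powr p) + ennreal (\<bar>c - d\<bar> powr p))"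
proof -
  let ?M = "max (max \<bar>a - b\<bar> \<bar>b - c\<bar>) \<bar>c - d\<bar>"
  have "\<bar>a - d\<bar> powr p \<le> (4 * ?M) powr p"
  proof (intro powr_mono2)
    have "\<bar>a - b\<bar> \<le> ?M" "\<bar>b - c\<bar> \<le> ?M" "\<bar>c - d\<bar> \<le> ?M" by auto
    moreover have "\<bar>a - d\<bar> \<le> \<bar>a - b\<bar> + \<bar>b - c\<bar> + \<bar>c - d\<bar>" "0 \<le> \<bar>a - b\<bar>" by arith+
    ultimately show "\<bar>a - d\<bar> \<le> 4 * ?M" by linarith
  qed (use assms in auto)
  also have "\<dots> = 4 powr p * ?M powr p"
    by (simp add: powr_mult)
  also have "?M powr p \<le> \<bar>a - b\<bar> powr p + \<bar>b - c\<bar> powr p + \<bar>c - d\<bar> powr p"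
    by (auto simp: max_def)
  finally show ?thesis
    by (simp flip: ennreal_mult ennreal_plus)
qed

text \<open>For a measure on the whole type this is the p-th power of
  \<open>besov_E\<close>.\<close>

definition lp_avg_diff :: "real \<Rightarrow> 'a::metric_space measure \<Rightarrow> ('a \<Rightarrow> real) \<Rightarrow> real \<Rightarrow> ennreal" where
  "lp_avg_diff p \<nu> f t = (\<integral>\<^sup>+x. (1 / emeasure \<nu> (ball x t)) * (\<integral>\<^sup>+y. near t x y * ennreal (\<bar>f y - f x\<bar> powr p) \<partial>\<nu>) \<partial>\<nu>)"

context trace_setting
begin

lemma Lp_trace_measurable [measurable]:
  assumes "f \<in> Lp" shows "trace_op m f \<in> borel_measurable borel"
  using Lp_measurable[OF assms] unfolding trace_op_def by measurable

definition \<rho> :: real where "\<rho> = (1 / 2) powr \<beta>"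

lemma \<rho>: "0 < \<rho>" "\<rho> < 1"
  using powr_less_mono2[of \<beta> "1 / 2" 1] \<beta>(1) by (auto simp: \<rho>_def)

lemma half_power_powr: "((1 / 2) ^ k) powr (\<beta> * p) = (\<rho> ^ k) powr p"
proof -
  have "((1 / 2) ^ k) powr \<beta> = \<rho> ^ k"
    unfolding \<rho>_def by (induction k) (simp_all only: power_Suc power_0 powr_mult powr_one_eq_one)
  then show ?thesis by (simp flip: powr_powr)
qed

text \<open>The sequence \<open>b\<^sub>k\<close> is comparable to \<open>(2\<^sup>k\<^sup>\<alpha> E\<^sub>p f(2\<^sup>-\<^sup>k))\<^sup>p\<close>.\<close>

definition bseq :: "('a \<Rightarrow> real) \<Rightarrow> nat \<Rightarrow> ennreal" where
  "bseq f k = ennreal (((1 / 2) ^ k) powr - (N + \<alpha> * p)) * lp_diff p m f (4 * (1 / 2) ^ k)"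

text \<open>What Jensen's inequality leaves of the increments from scale \<open>k\<close> on; the
  geometric weights are those inserted in \<open>nn_integral_sum_increments_le\<close>.\<close>

definition btail :: "('a \<Rightarrow> real) \<Rightarrow> nat \<Rightarrow> ennreal" where
  "btail f k = (\<Sum>i. ennreal (\<rho> ^ i) * bseq f (k + i))"

lemma bseq_le_btail: "bseq f k \<le> btail f k"
  using sum_le_suminf[OF summableI, of "{0}" "\<lambda>i. ennreal (\<rho> ^ i) * bseq f (k + i)"]
  by (simp add: btail_def)

text \<open>By the choice of \<beta>,
  \<open>\<beta> * p - (N + \<alpha> * p) = \<delta> - 2 * N\<close>. The radius
  \<open>4 * (1 / 2) ^ k\<close> in \<open>bseq\<close> leaves room for the radii
  \<open>r + s\<close> and \<open>2 * r + t\<close> that the triangle inequality produces.\<close>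

lemma lp_diff_le_bseq:
  assumes "t \<le> 4 * (1 / 2) ^ k"
  shows "ennreal (((1 / 2) ^ k) powr (\<delta> - 2 * N)) * lp_diff p m f t \<le> ennreal ((\<rho> ^ k) powr p) * bseq f k"
proof -
  let ?r = "(1 / 2 :: real) ^ k"
  have e: "\<beta> * p + - (N + \<alpha> * p) = \<delta> - 2 * N"
    using p \<beta> by (simp add: field_simps)
  have "ennreal (?r powr (\<delta> - 2 * N)) * lp_diff p m f t \<le> ennreal (?r powr (\<delta> - 2 * N)) * lp_diff p m f (4 * ?r)"
    by (intro mult_left_mono lp_diff_mono assms) auto
  also have "\<dots> = ennreal (?r powr (\<beta> * p) * ?r powr - (N + \<alpha> * p)) * lp_diff p m f (4 * ?r)"
    by (simp only: e[symmetric] powr_add)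
  also have "\<dots> = ennreal ((\<rho> ^ k) powr p) * bseq f k"
    unfolding bseq_def half_power_powr by (subst ennreal_mult) (auto simp: mult.assoc)
  finally show ?thesis .
qed

section \<open>Increments between consecutive dyadic scales\<close>

definition c1 :: real where "c1 = C\<^sup>2 * K * (1 / 2) powr (\<delta> - N)"

lemma c1: "c1 > 0" using pos by (simp add: c1_def)

lemma nn_integral_increment_le:
  assumes f: "f \<in> Lp"
  shows "(\<integral>\<^sup>+x. ennreal (\<bar>avg m ((1 / 2) ^ (k + 1)) f x - avg m ((1 / 2) ^ k) f x\<bar> powr p) \<partial>\<mu>)
    \<le> ennreal (c1 * (\<rho> ^ k) powr p) * bseq f k"
proof -
  let ?r = "(1 / 2 :: real) ^ k"
  have r: "?r > 0" by simp
  \<comment> \<open>The radii are \<open>?r / 2\<close> and \<open>?r\<close>: the powers of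
    \<open>?r\<close> combine to the exponent \<open>\<delta> - 2 * N\<close>, and \<open>c1\<close>
    absorbs the factor from the halving.\<close>
  have c: "C\<^sup>2 * K * ((?r / 2) powr (\<delta> - N) * ?r powr - N) = c1 * ?r powr (\<delta> - 2 * N)"
  proof -
    have "(?r / 2) powr (\<delta> - N) = (1 / 2) powr (\<delta> - N) * ?r powr (\<delta> - N)"
      using r by (simp flip: powr_mult)
    moreover have "?r powr (\<delta> - N) * ?r powr - N = ?r powr (\<delta> - 2 * N)"
      by (subst powr_add[symmetric]) simp
    ultimately show ?thesis unfolding c1_def by (simp only: mult.assoc)
  qed
  have "(\<integral>\<^sup>+x. ennreal (\<bar>avg m (?r / 2) f x - avg m ?r f x\<bar> powr p) \<partial>\<mu>)
     \<le> ennreal (C\<^sup>2 * K * ((?r / 2) powr (\<delta> - N) * ?r powr - N)) * lp_diff p m f (?r / 2 + ?r)"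
    by (intro nn_integral_avg_radii_le f) auto
  also have "\<dots> = ennreal c1 * (ennreal (?r powr (\<delta> - 2 * N)) * lp_diff p m f (?r / 2 + ?r))"
    using c1 unfolding c by (subst ennreal_mult) (auto simp: mult.assoc)
  also have "\<dots> \<le> ennreal c1 * (ennreal ((\<rho> ^ k) powr p) * bseq f k)"
    by (intro mult_left_mono lp_diff_le_bseq) auto
  also have "\<dots> = ennreal (c1 * (\<rho> ^ k) powr p) * bseq f k"
    using c1 by (simp add: ennreal_mult mult.assoc)
  finally show ?thesis by simp
qed

definition c2 :: real where "c2 = (1 / (1 - \<rho>)) powr (p - 1) * c1"

lemma c2: "c2 > 0" using c1 \<rho> by (simp add: c2_def)

text \<open>Each increment is written as \<open>\<rho> ^ i\<close> times its quotient by
  \<open>\<rho> ^ i\<close>, and Jensen's inequality is applied with these weights. The p-th power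
  of the quotient costs \<rho> to the power -ip, which the bound for the increment at scale
  \<open>k + i\<close> compensates, so that \<open>\<rho> ^ i\<close> remains.\<close>

lemma nn_integral_sum_increments_le:
  assumes f: "f \<in> Lp"
  defines "\<Delta> \<equiv> \<lambda>k x. \<bar>avg m ((1 / 2) ^ (k + 1)) f x - avg m ((1 / 2) ^ k) f x\<bar>"
  shows "(\<integral>\<^sup>+x. ennpowr (\<Sum>i. ennreal (\<Delta> (k + i) x)) p \<partial>\<mu>) \<le> ennreal (c2 * (\<rho> ^ k) powr p) * btail f k"
proof -
  note [measurable] = Lp_measurable[OF f]
  let ?S = "(1 / (1 - \<rho>)) powr (p - 1)"
  have \<Delta>_nonneg: "\<Delta> i x \<ge> 0" for i x by (simp add: \<Delta>_def)
  have [measurable]: "\<Delta> i \<in> borel_measurable borel" for i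
    unfolding \<Delta>_def by measurable
  let ?w = "\<lambda>i. \<rho> ^ i * ((1 / \<rho>) ^ i) powr p"
  have w: "?w i \<ge> 0" for i using \<rho> by simp
  have "ennpowr (\<Sum>i. ennreal (\<Delta> (k + i) x)) p \<le> ennreal ?S * (\<Sum>i. ennreal (?w i) * ennreal (\<Delta> (k + i) x powr p))" for x
  proof -
    have 1: "(\<Sum>i. ennreal (\<Delta> (k + i) x)) = (\<Sum>i. ennreal (\<rho> ^ i) * ennreal ((1 / \<rho>) ^ i * \<Delta> (k + i) x))"
      using \<rho> \<Delta>_nonneg by (intro suminf_cong) (simp add: power_divide flip: ennreal_mult)
    have 2: "ennreal (\<rho> ^ i) * ennpowr (ennreal ((1 / \<rho>) ^ i * \<Delta> (k + i) x)) p = ennreal (?w i) * ennreal (\<Delta> (k + i) x powr p)" for i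
      using \<rho> p \<Delta>_nonneg by (simp add: ennpowr_ennreal powr_mult mult.assoc flip: ennreal_mult)
    show ?thesis
      unfolding 1 using suminf_Jensen[OF p, of "\<lambda>i. ennreal (\<rho> ^ i)" "\<lambda>i. ennreal ((1 / \<rho>) ^ i * \<Delta> (k + i) x)"] p \<rho>
      by (simp only: 2 suminf_ennreal_geometric[OF \<rho>]) (simp add: ennpowr_ennreal)
  qed
  then have "(\<integral>\<^sup>+x. ennpowr (\<Sum>i. ennreal (\<Delta> (k + i) x)) p \<partial>\<mu>) \<le>
      (\<integral>\<^sup>+x. ennreal ?S * (\<Sum>i. ennreal (?w i) * ennreal (\<Delta> (k + i) x powr p)) \<partial>\<mu>)"
    by (intro nn_integral_mono)
  also have "\<dots> = ennreal ?S * (\<Sum>i. ennreal (?w i) * (\<integral>\<^sup>+x. ennreal (\<Delta> (k + i) x powr p) \<partial>\<mu>))"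
    by (simp add: nn_integral_cmult nn_integral_suminf del: ennreal_suminf_cmult)
  also have "\<dots> \<le> ennreal ?S * (\<Sum>i. ennreal (?w i) * (ennreal (c1 * (\<rho> ^ (k + i)) powr p) * bseq f (k + i)))"
    unfolding \<Delta>_def by (intro mult_left_mono suminf_le summableI nn_integral_increment_le f) auto
  also have "(\<lambda>i. ennreal (?w i) * (ennreal (c1 * (\<rho> ^ (k + i)) powr p) * bseq f (k + i))) =
      (\<lambda>i. ennreal (c1 * (\<rho> ^ k) powr p) * (ennreal (\<rho> ^ i) * bseq f (k + i)))"
  proof
    fix i
    have "?w i * (c1 * (\<rho> ^ (k + i)) powr p) = (c1 * (\<rho> ^ k) powr p) * \<rho> ^ i"
      using \<rho> by (simp add: power_add powr_mult power_divide powr_divide)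
    then have "ennreal (?w i) * ennreal (c1 * (\<rho> ^ (k + i)) powr p) = ennreal (c1 * (\<rho> ^ k) powr p) * ennreal (\<rho> ^ i)"
      using w c1 \<rho> by (simp only: ennreal_mult[symmetric] zero_le_mult_iff) (simp flip: ennreal_mult)
    then show "ennreal (?w i) * (ennreal (c1 * (\<rho> ^ (k + i)) powr p) * bseq f (k + i)) =
        ennreal (c1 * (\<rho> ^ k) powr p) * (ennreal (\<rho> ^ i) * bseq f (k + i))"
      by (simp only: mult.assoc[symmetric])
  qed
  also have "ennreal ?S * (\<Sum>i. ennreal (c1 * (\<rho> ^ k) powr p) * (ennreal (\<rho> ^ i) * bseq f (k + i))) =
      (ennreal ?S * ennreal (c1 * (\<rho> ^ k) powr p)) * btail f k"
    by (simp add: btail_def mult.assoc)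
  also have "ennreal ?S * ennreal (c1 * (\<rho> ^ k) powr p) = ennreal (c2 * (\<rho> ^ k) powr p)"
    using c1 unfolding c2_def by (subst ennreal_mult[symmetric]) (auto simp: mult.assoc)
  finally show ?thesis .
qed

text \<open>The p-th power of the sum of all increments has a finite \<mu>-integral, so this sum is
  finite almost everywhere.\<close>

lemma AE_convergent_avg:
  assumes f: "f \<in> Lp" and fin: "btail f 0 < \<infinity>"
  shows "AE x in \<mu>. convergent (\<lambda>k. avg m ((1 / 2) ^ k) f x)"
proof -
  note [measurable] = Lp_measurable[OF f]
  let ?s = "\<lambda>x. \<Sum>i. ennreal \<bar>avg m ((1 / 2) ^ (0 + i + 1)) f x - avg m ((1 / 2) ^ (0 + i)) f x\<bar>"
  have "(\<integral>\<^sup>+x. ennpowr (?s x) p \<partial>\<mu>) < \<infinity>"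
    using nn_integral_sum_increments_le[OF f, of 0] fin by (auto simp: ennreal_mult_less_top intro: le_less_trans)
  then have "AE x in \<mu>. ennpowr (?s x) p \<noteq> \<infinity>"
    by (intro nn_integral_PInf_AE) auto
  then show ?thesis
  proof eventually_elim
    case (elim x)
    then have "?s x < \<infinity>"
      by (cases "?s x") auto
    then show ?case
      by (intro lim_diff_le_suminf(2)) simp
  qed
qed

lemma nn_integral_trace_diff_le:
  assumes f: "f \<in> Lp"
  shows "(\<integral>\<^sup>+x. ennreal (\<bar>trace_op m f x - avg m ((1 / 2) ^ k) f x\<bar> powr p) \<partial>\<mu>) \<le>
    ennreal (c2 * (\<rho> ^ k) powr p) * btail f k"
proof -
  have "ennreal (\<bar>trace_op m f x - avg m ((1 / 2) ^ k) f x\<bar> powr p) \<le>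
     ennpowr (\<Sum>i. ennreal \<bar>avg m ((1 / 2) ^ (k + i + 1)) f x - avg m ((1 / 2) ^ (k + i)) f x\<bar>) p" for x
  proof -
    have "ennreal (\<bar>trace_op m f x - avg m ((1 / 2) ^ k) f x\<bar> powr p) = ennpowr (ennreal \<bar>trace_op m f x - avg m ((1 / 2) ^ k) f x\<bar>) p"
      using p by (simp add: ennpowr_ennreal)
    also have "\<dots> \<le> ennpowr (\<Sum>i. ennreal \<bar>avg m ((1 / 2) ^ (k + i + 1)) f x - avg m ((1 / 2) ^ (k + i)) f x\<bar>) p"
      unfolding trace_op_def using p by (intro ennpowr_mono lim_diff_le_suminf(1)) auto
    finally show ?thesis .
  qed
  then show ?thesis
    by (intro order_trans[OF nn_integral_mono nn_integral_sum_increments_le[OF f]])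
qed

text \<open>Averaging the term with \<open>g x\<close> over a ball returns at most
  \<open>g x\<close>. For the term with \<open>g y\<close> the integrals are exchanged, and doubling
  replaces the ball around \<open>x\<close> by the one around \<open>y\<close> at the cost of
  \<open>E\<close>.\<close>

lemma lp_avg_sum_le:
  assumes [measurable]: "g \<in> borel_measurable borel" and t: "t > 0"
  shows "(\<integral>\<^sup>+x. (1 / emeasure \<mu> (ball x t)) * (\<integral>\<^sup>+y. near t x y * (g x + g y) \<partial>\<mu>) \<partial>\<mu>) \<le> ennreal (1 + E) * (\<integral>\<^sup>+x. g x \<partial>\<mu>)"
proof -
  let ?V = "\<lambda>x. emeasure \<mu> (ball x t)"
  \<comment> \<open>Off \<open>F\<close> a ball may have mass 0; then \<open>1 / ?V x\<close> is
    infinite, and its product with 0 is 0.\<close>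
  have V1: "1 / ?V x * ?V x \<le> 1" for x
    by (cases "?V x = 0") (simp_all add: ennreal_divide_times)
  have "(\<integral>\<^sup>+x. (1 / ?V x) * (\<integral>\<^sup>+y. near t x y * (g x + g y) \<partial>\<mu>) \<partial>\<mu>) =
      (\<integral>\<^sup>+x. (1 / ?V x * ?V x) * g x + (1 / ?V x) * (\<integral>\<^sup>+y. near t x y * g y \<partial>\<mu>) \<partial>\<mu>)"
    by (intro nn_integral_cong) (simp add: distrib_left nn_integral_add nn_integral_multc mult.assoc)
  also have "\<dots> = (\<integral>\<^sup>+x. (1 / ?V x * ?V x) * g x \<partial>\<mu>) + (\<integral>\<^sup>+x. (1 / ?V x) * (\<integral>\<^sup>+y. near t x y * g y \<partial>\<mu>) \<partial>\<mu>)"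
    by (intro nn_integral_add) measurable
  also have "(\<integral>\<^sup>+x. (1 / ?V x) * (\<integral>\<^sup>+y. near t x y * g y \<partial>\<mu>) \<partial>\<mu>) = (\<integral>\<^sup>+x. \<integral>\<^sup>+y. (1 / ?V x) * near t x y * g y \<partial>\<mu> \<partial>\<mu>)"
    by (simp add: nn_integral_cmult mult.assoc)
  also have "\<dots> = (\<integral>\<^sup>+y. \<integral>\<^sup>+x. (1 / ?V x) * near t x y * g y \<partial>\<mu> \<partial>\<mu>)"
    by (rule pair_sigma_finite.Fubini'[OF pair_sigma_finite(2), symmetric]) measurable
  also have "\<dots> \<le> (\<integral>\<^sup>+y. ennreal E * g y \<partial>\<mu>)"
  proof (rule nn_integral_mono_AE, use F in eventually_elim)
    fix y assume y: "y \<in> F"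
    have "(\<integral>\<^sup>+x. (1 / ?V x) * near t x y * g y \<partial>\<mu>) \<le> (\<integral>\<^sup>+x. near t y x * (ennreal E / ?V y * g y) \<partial>\<mu>)"
    proof (rule nn_integral_mono_AE, use F in eventually_elim)
      fix x assume x: "x \<in> F"
      have "1 / ?V x \<le> ennreal E / ?V y" if "dist x y < t"
      proof -
        \<comment> \<open>Expanding the fraction by \<open>E\<close> lets doubling compare the
          denominators.\<close>
        have "1 / ?V x = ennreal E / (ennreal E * ?V x)"
          using pos \<mu>_ball_pos[OF t x] by (subst divide_mult_eq[symmetric, where a = "ennreal E" and x = 1]) (auto simp: mult.commute)
        also have "\<dots> \<le> ennreal E / ?V y"
          by (intro ennreal_divide_antimono \<mu>_doubling x y that)
        finally show ?thesis .
      qed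
      then show "(1 / ?V x) * near t x y * g y \<le> near t y x * (ennreal E / ?V y * g y)"
        by (auto simp: near_def dist_commute intro!: mult_right_mono)
    qed
    also have "\<dots> = ?V y * (ennreal E / ?V y * g y)"
      by (simp add: nn_integral_multc)
    also have "\<dots> = ennreal E * g y"
    proof -
      have "?V y * (ennreal E / ?V y * g y) = ennreal E * g y * (?V y / ?V y)"
        by (simp add: ennreal_times_divide ennreal_divide_times mult_ac)
      also have "?V y / ?V y = 1"
        using \<mu>_ball_pos[OF t y] by (intro ennreal_divide_self) auto
      finally show ?thesis by simp
    qed
    finally show "(\<integral>\<^sup>+x. (1 / ?V x) * near t x y * g y \<partial>\<mu>) \<le> ennreal E * g y" .
  qed
  also have "\<dots> = ennreal E * (\<integral>\<^sup>+x. g x \<partial>\<mu>)"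
    by (simp add: nn_integral_cmult)
  also have "(\<integral>\<^sup>+x. (1 / ?V x * ?V x) * g x \<partial>\<mu>) \<le> (\<integral>\<^sup>+x. g x \<partial>\<mu>)"
    using V1 by (intro nn_integral_mono) (metis mult_1 mult_right_mono zero_le)
  finally show ?thesis
    using pos by (simp add: ennreal_plus distrib_right)
qed

definition c3 :: real where "c3 = 4 powr p * ((1 + E) * c2 + C\<^sup>2 * K\<^sup>2 * L)"

lemma c3: "c3 > 0" using c2 pos by (simp add: c3_def add_pos_pos)

text \<open>The trace is compared with the average at scale \<open>k\<close> at both points. The two
  errors are controlled by \<open>lp_avg_sum_le\<close> and
  \<open>nn_integral_trace_diff_le\<close>, the difference of the averages by
  \<open>nn_integral_avg_centers_le\<close>, where \<open>2 * r + t \<le> 3 * r\<close> for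
  \<open>r = (1 / 2) ^ k\<close>.\<close>

lemma lp_avg_diff_trace_le:
  assumes f: "f \<in> Lp" and t: "0 < t" "t \<le> (1 / 2) ^ k"
  shows "lp_avg_diff p \<mu> (trace_op m f) t \<le> ennreal (c3 * (\<rho> ^ k) powr p) * btail f k"
proof -
  note [measurable] = Lp_measurable[OF f] Lp_trace_measurable[OF f]
  let ?r = "(1 / 2 :: real) ^ k"
  let ?R = "trace_op m f" and ?A = "avg m ?r f"
  let ?g = "\<lambda>x. ennreal (\<bar>?R x - ?A x\<bar> powr p)"
  let ?V = "\<lambda>x. 1 / emeasure \<mu> (ball x t)"
  let ?B = "ennreal ((\<rho> ^ k) powr p) * btail f k"
  have r1: "?r \<le> 1" by (simp add: power_le_one)
  have "lp_avg_diff p \<mu> ?R t \<le> (\<integral>\<^sup>+x. ?V x * (\<integral>\<^sup>+y. near t x y * (ennreal (4 powr p) *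
      ((?g x + ?g y) + ennreal (\<bar>?A y - ?A x\<bar> powr p))) \<partial>\<mu>) \<partial>\<mu>)"
    unfolding lp_avg_diff_def
  proof (intro nn_integral_mono mult_left_mono)
    fix x y
    show "ennreal (\<bar>?R y - ?R x\<bar> powr p) \<le> ennreal (4 powr p) * ((?g x + ?g y) + ennreal (\<bar>?A y - ?A x\<bar> powr p))"
      using powr_add3_le[of p "?R y" "?R x" "?A y" "?A x"] p by (simp add: abs_minus_commute add_ac)
  qed auto
  also have "\<dots> = (\<integral>\<^sup>+x. ennreal (4 powr p) * (?V x * (\<integral>\<^sup>+y. near t x y * (?g x + ?g y) \<partial>\<mu>) +
      ?V x * (\<integral>\<^sup>+y. near t x y * ennreal (\<bar>?A y - ?A x\<bar> powr p) \<partial>\<mu>)) \<partial>\<mu>)"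
    by (intro nn_integral_cong)
      (simp add: mult.left_commute[of _ "ennreal (4 powr p)"] nn_integral_cmult distrib_left[of "near _ _ _"] 
        nn_integral_add distrib_left[of "?V _"])
  also have "\<dots> = ennreal (4 powr p) * ((\<integral>\<^sup>+x. ?V x * (\<integral>\<^sup>+y. near t x y * (?g x + ?g y) \<partial>\<mu>) \<partial>\<mu>) +
      (\<integral>\<^sup>+x. ?V x * (\<integral>\<^sup>+y. near t x y * ennreal (\<bar>?A y - ?A x\<bar> powr p) \<partial>\<mu>) \<partial>\<mu>))"
    by (simp add: nn_integral_cmult nn_integral_add)
  also have "\<dots> \<le> ennreal (4 powr p) * (ennreal (1 + E) * (ennreal c2 * ?B) + ennreal (C\<^sup>2 * K\<^sup>2 * L) * ?B)"
  proof (intro mult_left_mono add_mono)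
    have "(\<integral>\<^sup>+x. ?V x * (\<integral>\<^sup>+y. near t x y * (?g x + ?g y) \<partial>\<mu>) \<partial>\<mu>) \<le> ennreal (1 + E) * (\<integral>\<^sup>+x. ?g x \<partial>\<mu>)"
      using t by (intro lp_avg_sum_le) auto
    also have "\<dots> \<le> ennreal (1 + E) * (ennreal (c2 * (\<rho> ^ k) powr p) * btail f k)"
      by (intro mult_left_mono nn_integral_trace_diff_le f) auto
    also have "\<dots> = ennreal (1 + E) * (ennreal c2 * ?B)"
      using c2 by (simp add: ennreal_mult mult.assoc)
    finally show "(\<integral>\<^sup>+x. ?V x * (\<integral>\<^sup>+y. near t x y * (?g x + ?g y) \<partial>\<mu>) \<partial>\<mu>) \<le> \<dots>" .
    have "(\<integral>\<^sup>+x. ?V x * (\<integral>\<^sup>+y. near t x y * ennreal (\<bar>?A y - ?A x\<bar> powr p) \<partial>\<mu>) \<partial>\<mu>) \<le>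
        ennreal (C\<^sup>2 * K\<^sup>2 * L * ?r powr (\<delta> - 2 * N)) * lp_diff p m f (2 * ?r + t)"
      using t r1 by (intro nn_integral_avg_centers_le f) auto
    also have "\<dots> = ennreal (C\<^sup>2 * K\<^sup>2 * L) * (ennreal (?r powr (\<delta> - 2 * N)) * lp_diff p m f (2 * ?r + t))"
      using pos by (simp add: ennreal_mult mult.assoc)
    also have "\<dots> \<le> ennreal (C\<^sup>2 * K\<^sup>2 * L) * (ennreal ((\<rho> ^ k) powr p) * bseq f k)"
      using t by (intro mult_left_mono lp_diff_le_bseq) auto
    also have "\<dots> \<le> ennreal (C\<^sup>2 * K\<^sup>2 * L) * ?B"
      by (intro mult_left_mono bseq_le_btail) auto
    finally show "(\<integral>\<^sup>+x. ?V x * (\<integral>\<^sup>+y. near t x y * ennreal (\<bar>?A y - ?A x\<bar> powr p) \<partial>\<mu>) \<partial>\<mu>) \<le> \<dots>" .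
  qed auto
  also have "\<dots> = ennreal c3 * ?B"
  proof -
    have "ennreal c3 = ennreal (4 powr p) * (ennreal (1 + E) * ennreal c2 + ennreal (C\<^sup>2 * K\<^sup>2 * L))"
      unfolding c3_def using pos c2
      by (subst ennreal_mult, simp, simp, subst ennreal_plus, simp, simp, subst ennreal_mult, simp_all)
    then show ?thesis by (simp only: distrib_right mult.assoc)
  qed
  also have "\<dots> = ennreal (c3 * (\<rho> ^ k) powr p) * btail f k"
    using c3 by (simp add: ennreal_mult mult.assoc)
  finally show ?thesis .
qed

text \<open>Uses only the size of \<open>g\<close>. It serves the scales \<open>t > 1\<close>, where
  the weight in the Besov norm decays fast enough.\<close>

lemma lp_avg_diff_le:
  assumes [measurable]: "g \<in> borel_measurable borel" and t: "0 < t"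
  shows "lp_avg_diff p \<mu> g t \<le> ennreal (4 powr p * (1 + E)) * (\<integral>\<^sup>+x. ennreal (\<bar>g x\<bar> powr p) \<partial>\<mu>)"
proof -
  let ?g = "\<lambda>x. ennreal (\<bar>g x\<bar> powr p)"
  let ?V = "\<lambda>x. 1 / emeasure \<mu> (ball x t)"
  have "lp_avg_diff p \<mu> g t \<le> (\<integral>\<^sup>+x. ?V x * (\<integral>\<^sup>+y. near t x y * (ennreal (4 powr p) * (?g x + ?g y)) \<partial>\<mu>) \<partial>\<mu>)"
    unfolding lp_avg_diff_def
  proof (intro nn_integral_mono mult_left_mono)
    fix x y
    show "ennreal (\<bar>g y - g x\<bar> powr p) \<le> ennreal (4 powr p) * (?g x + ?g y)"
      using powr_add3_le[of p "g y" "g x" 0 0] p by (simp add: add_ac)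
  qed auto
  also have "\<dots> = ennreal (4 powr p) * (\<integral>\<^sup>+x. ?V x * (\<integral>\<^sup>+y. near t x y * (?g x + ?g y) \<partial>\<mu>) \<partial>\<mu>)"
    by (simp add: mult.left_commute[of _ "ennreal (4 powr p)"] nn_integral_cmult)
  also have "\<dots> \<le> ennreal (4 powr p) * (ennreal (1 + E) * (\<integral>\<^sup>+x. ?g x \<partial>\<mu>))"
    using t by (intro mult_left_mono lp_avg_sum_le) auto
  also have "\<dots> = ennreal (4 powr p * (1 + E)) * (\<integral>\<^sup>+x. ennreal (\<bar>g x\<bar> powr p) \<partial>\<mu>)"
    using pos by (simp add: ennreal_mult mult.assoc)
  finally show ?thesis .
qed

end


section \<open>Dyadic form of the Besov norm\<close>

lemma disjoint_dyadic: "disjoint_family (\<lambda>k. {a * (1 / 2) ^ Suc k <.. a * (1 / 2 :: real) ^ k})" if "a > 0"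
  unfolding disjoint_family_on_def
proof (intro ballI impI)
  fix i j :: nat assume "i \<noteq> j"
  have "{a * (1 / 2) ^ Suc i <.. a * (1 / 2 :: real) ^ i} \<inter> {a * (1 / 2) ^ Suc j <.. a * (1 / 2) ^ j} = {}" if "i < j" for i j
    using that \<open>a > 0\<close> power_decreasing[of "Suc i" j "1 / 2 :: real"] 
    by (auto simp: mult_le_cancel_left_pos simp del: power_Suc dest: mult_left_mono[of _ _ a])
  with \<open>i \<noteq> j\<close> show "{a * (1 / 2) ^ Suc i <.. a * (1 / 2 :: real) ^ i} \<inter> {a * (1 / 2) ^ Suc j <.. a * (1 / 2) ^ j} = {}"
    by (metis Int_commute linorder_neqE_nat)
qed

text \<open>The least \<open>n\<close> with \<open>(1 / 2) ^ n < t\<close> is positive because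
  \<open>t \<le> 1\<close>; its predecessor is \<open>k\<close>.\<close>

lemma dyadic_cases:
  assumes "0 < t" "t \<le> (1::real)"
  obtains k where "(1 / 2) ^ Suc k < t" "t \<le> (1 / 2) ^ k"
proof -
  obtain n where n: "(1 / 2 :: real) ^ n < t"
    using real_arch_pow_inv[of t "1 / 2"] assms by auto
  define j where "j = (LEAST n. (1 / 2 :: real) ^ n < t)"
  have j: "(1 / 2 :: real) ^ j < t" unfolding j_def by (rule LeastI) (rule n)
  then have "j \<noteq> 0" using assms by (intro notI) simp
  then obtain k where k: "j = Suc k" by (cases j) auto
  then have "\<not> (1 / 2 :: real) ^ k < t"
    using not_less_Least[of k "\<lambda>n. (1 / 2 :: real) ^ n < t"] by (simp add: j_def)
  with j k show ?thesis by (intro that) auto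
qed

text \<open>The interval from \<open>4 * (1 / 2) ^ k\<close> to \<open>8 * (1 / 2) ^ k\<close> has
  length \<open>4 * (1 / 2) ^ k\<close>, and there \<open>1 / t\<close> is at least
  \<open>1 / (8 * (1 / 2) ^ k)\<close>: its mass for dt/t is at least 1/2, whence the factor 2. It
  starts at the radius used in \<open>bseq\<close>, so that monotonicity of \<open>lp_diff\<close>
  applies.\<close>

lemma dyadic_sum_le_nn_integral:
  fixes w :: "nat \<Rightarrow> ennreal"
  assumes w: "\<And>k t. 4 * (1 / 2) ^ k < t \<Longrightarrow> t \<le> 8 * (1 / 2) ^ k \<Longrightarrow> w k \<le> G t"
  shows "(\<Sum>k. w k) \<le> 2 * (\<integral>\<^sup>+t\<in>{0<..}. G t * ennreal (1 / t) \<partial>lborel)"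
proof -
  \<comment> \<open>The left end \<open>4 * (1 / 2) ^ k\<close> is written with \<open>Suc k\<close>
    to match \<open>disjoint_dyadic\<close>.\<close>
  let ?I = "\<lambda>k. {8 * (1 / 2 :: real) ^ Suc k <.. 8 * (1 / 2) ^ k}"
  let ?r = "\<lambda>k. (1 / 2 :: real) ^ k"
  have I: "?I k = {4 * ?r k <.. 8 * ?r k}" for k by simp
  have "(\<Sum>k. w k) = 2 * (\<Sum>k. w k * ennreal (1 / 2))"
    using ennreal_mult[of 2 "1 / 2"] by (simp add: mult.left_commute[of 2] del: ennreal_suminf_cmult ennreal_suminf_multc
        flip: ennreal_suminf_cmult)
  also have "(\<Sum>k. w k * ennreal (1 / 2)) = (\<Sum>k. \<integral>\<^sup>+t. (w k * ennreal (1 / (8 * ?r k))) * indicator (?I k) t \<partial>lborel)"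
  proof (rule suminf_cong)
    fix k
    have "(\<integral>\<^sup>+t. (w k * ennreal (1 / (8 * ?r k))) * indicator (?I k) t \<partial>lborel) = w k * (ennreal (1 / (8 * ?r k)) * ennreal (4 * ?r k))"
      unfolding I by (subst nn_integral_cmult_indicator) (auto simp: mult.assoc)
    also have "ennreal (1 / (8 * ?r k)) * ennreal (4 * ?r k) = ennreal (1 / 2)"
      by (subst ennreal_mult[symmetric]) auto
    finally show "w k * ennreal (1 / 2) = (\<integral>\<^sup>+t. (w k * ennreal (1 / (8 * ?r k))) * indicator (?I k) t \<partial>lborel)" ..
  qed
  also have "\<dots> = (\<integral>\<^sup>+t. (\<Sum>k. (w k * ennreal (1 / (8 * ?r k))) * indicator (?I k) t) \<partial>lborel)"
    by (intro nn_integral_suminf[symmetric]) measurable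
  also have "\<dots> \<le> (\<integral>\<^sup>+t\<in>{0<..}. G t * ennreal (1 / t) \<partial>lborel)"
  proof (rule nn_integral_mono)
    fix t :: real
    show "(\<Sum>k. (w k * ennreal (1 / (8 * ?r k))) * indicator (?I k) t) \<le> G t * ennreal (1 / t) * indicator {0<..} t"
    proof (cases "\<exists>k. t \<in> ?I k")
      case True
      then obtain k where k: "t \<in> ?I k" by auto
      then have t: "4 * ?r k < t" "t \<le> 8 * ?r k" unfolding I by auto
      have t0: "t > 0" using t(1) by (rule less_trans[rotated]) simp
      have "(\<Sum>k. (w k * ennreal (1 / (8 * ?r k))) * indicator (?I k) t) = w k * ennreal (1 / (8 * ?r k))"
        by (rule suminf_cmult_indicator[OF disjoint_dyadic k]) simp
      also have "\<dots> \<le> G t * ennreal (1 / t)"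
        using t t0 by (intro mult_mono w t ennreal_leI divide_left_mono) auto
      finally show ?thesis using t0 by simp
    next
      case False
      then have "(\<lambda>k. (w k * ennreal (1 / (8 * ?r k))) * indicator (?I k) t) = (\<lambda>_. 0)"
        by (auto simp: fun_eq_iff split: split_indicator)
      then show ?thesis by simp
    qed
  qed
  finally show ?thesis by (simp add: mult_left_mono)
qed

lemma nn_integral_powr_atLeast_1:
  assumes s: "s > (0::real)"
  shows "(\<integral>\<^sup>+t\<in>{1..}. ennreal (t powr (- s - 1)) \<partial>lborel) = ennreal (1 / s)"
proof -
  have "(\<integral>\<^sup>+t\<in>{1..}. ennreal (t powr (- s - 1)) \<partial>lborel) = ennreal (0 - (- (1 powr - s) / s))"
  proof (rule nn_integral_FTC_atLeast)
    fix x :: real assume "1 \<le> x"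
    then show "((\<lambda>t. - (t powr - s) / s) has_real_derivative x powr (- s - 1)) (at x)"
      using s by (auto intro!: derivative_eq_intros)
  next
    have "((\<lambda>t. t powr - s) \<longlongrightarrow> 0) at_top"
      using s by (intro tendsto_neg_powr filterlim_ident) auto
    from tendsto_divide[OF tendsto_minus[OF this] tendsto_const, of s]
    show "((\<lambda>t. - (t powr - s) / s) \<longlongrightarrow> 0) at_top" using s by simp
  qed auto
  then show ?thesis by simp
qed

text \<open>On the dyadic interval of index \<open>k\<close> the weight \<open>1 / t\<close> is at
  most \<open>1 / (1 / 2) ^ Suc k\<close>, the reciprocal of its length, so the interval contributes
  at most \<open>w k\<close>. Beyond 1, the integral of \<open>t powr (- s - 1)\<close> is
  \<open>1 / s\<close>.\<close>

lemma nn_integral_le_dyadic_sum: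
  fixes w :: "nat \<Rightarrow> ennreal"
  assumes w: "\<And>k t. 0 < t \<Longrightarrow> (1 / 2) ^ Suc k < t \<Longrightarrow> t \<le> (1 / 2) ^ k \<Longrightarrow> G t \<le> w k"
    and s: "s > 0" and B: "\<And>t. 1 < t \<Longrightarrow> G t \<le> ennreal (t powr - s) * B"
  shows "(\<integral>\<^sup>+t\<in>{0<..}. G t * ennreal (1 / t) \<partial>lborel) \<le> (\<Sum>k. w k) + ennreal (1 / s) * B"
proof -
  let ?r = "\<lambda>k. (1 / 2 :: real) ^ k"
  let ?I = "\<lambda>k. {1 * ?r (Suc k) <.. 1 * ?r k}"
  let ?g = "\<lambda>t. \<Sum>k. (w k * ennreal (1 / ?r (Suc k))) * indicator (?I k) t"
  have "(\<integral>\<^sup>+t\<in>{0<..}. G t * ennreal (1 / t) \<partial>lborel) \<le>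
     (\<integral>\<^sup>+t. ?g t + ennreal (t powr (- s - 1)) * indicator {1..} t * B \<partial>lborel)"
  proof (rule nn_integral_mono)
    fix t :: real
    consider "t \<le> 0" | "0 < t" "t \<le> 1" | "1 < t" by linarith
    then show "G t * ennreal (1 / t) * indicator {0<..} t \<le> ?g t + ennreal (t powr (- s - 1)) * indicator {1..} t * B"
    proof cases
      case 2
      then obtain k where k: "?r (Suc k) < t" "t \<le> ?r k" by (rule dyadic_cases)
      then have "t \<in> ?I k" by simp
      from suminf_cmult_indicator[OF disjoint_dyadic this] 
      have "?g t = w k * ennreal (1 / ?r (Suc k))" by simp
      moreover have "G t * ennreal (1 / t) \<le> w k * ennreal (1 / ?r (Suc k))"
        using k 2 by (intro mult_mono w k ennreal_leI divide_left_mono) (auto simp del: power_Suc)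
      ultimately show ?thesis using 2 by (simp add: add_increasing2 del: power_Suc)
    next
      case 3
      have "G t * ennreal (1 / t) \<le> (ennreal (t powr - s) * B) * ennreal (1 / t)"
        using 3 by (intro mult_right_mono B) auto
      also have "\<dots> = ennreal (t powr (- s - 1)) * B"
        using 3 by (simp add: powr_diff mult_ac flip: ennreal_mult)
      finally show ?thesis using 3 by (simp add: add_increasing)
    qed auto
  qed
  also have "\<dots> = (\<integral>\<^sup>+t. ?g t \<partial>lborel) + ennreal (1 / s) * B"
    by (subst nn_integral_add)
      (simp_all add: nn_integral_multc nn_integral_powr_atLeast_1[OF s])
  also have "(\<integral>\<^sup>+t. ?g t \<partial>lborel) = (\<Sum>k. \<integral>\<^sup>+t. (w k * ennreal (1 / ?r (Suc k))) * indicator (?I k) t \<partial>lborel)"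
    by (intro nn_integral_suminf) measurable
  also have "\<dots> = (\<Sum>k. w k)"
  proof (rule suminf_cong)
    fix k
    have "(\<integral>\<^sup>+t. (w k * ennreal (1 / ?r (Suc k))) * indicator (?I k) t \<partial>lborel) = w k * (ennreal (1 / ?r (Suc k)) * ennreal (?r k - ?r (Suc k)))"
      by (subst nn_integral_cmult_indicator) (auto simp: mult.assoc)
    also have "ennreal (1 / ?r (Suc k)) * ennreal (?r k - ?r (Suc k)) = 1"
      by (subst ennreal_mult[symmetric]) auto
    finally show "(\<integral>\<^sup>+t. (w k * ennreal (1 / ?r (Suc k))) * indicator (?I k) t \<partial>lborel) = w k" by simp
  qed
  finally show ?thesis .
qed

section \<open>Besov norms in terms of p-th powers\<close>

lemma besov_E_eq: "space \<nu> = UNIV \<Longrightarrow> besov_E p \<nu> f t = ennpowr (lp_avg_diff p \<nu> f t) (1 / p)"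
  by (simp add: besov_E_def lp_avg_diff_def near_eq mult.commute)

text \<open>Passes to p-th powers, so that the Hardy inequality can be used with exponent
  \<open>q / p\<close>.\<close>

lemma ennpowr_besov_term:
  assumes "p > 0" "q > 0" "t > 0"
  shows "ennpowr (ennreal (t powr - a) * ennpowr X (1 / p)) q = ennpowr (ennreal (t powr - (a * p)) * X) (q / p)"
proof -
  have "t powr - (a * p) = (t powr - a) powr p" by (simp add: powr_powr)
  then have "ennpowr (ennreal (t powr - a) * ennpowr X (1 / p)) q = ennpowr (ennpowr (ennreal (t powr - (a * p)) * X) (1 / p)) q"
    using assms by (simp add: ennpowr_mult ennpowr_ennreal powr_powr)
  also have "\<dots> = ennpowr (ennreal (t powr - (a * p)) * X) (q / p)"
    using assms by (simp add: ennpowr_ennpowr)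
  finally show ?thesis .
qed

definition besov_integral :: "real \<Rightarrow> real \<Rightarrow> real \<Rightarrow> 'a::metric_space measure \<Rightarrow> ('a \<Rightarrow> real) \<Rightarrow> ennreal" where
  "besov_integral \<alpha> p q \<nu> f = (\<integral>\<^sup>+t\<in>{0<..}. ennpowr (ennreal (t powr (- \<alpha>)) * besov_E p \<nu> f t) q * ennreal (1 / t) \<partial>lborel)"

locale besov_trace_setting = trace_setting +
  fixes q :: real
  assumes q: "q \<ge> 1" and \<alpha>N: "\<alpha> > 0" "N > 0"
begin

text \<open>The upper bound for the mass of balls bounds the normalisation from below.\<close>

lemma lp_avg_diff_ge:
  assumes f: "f \<in> Lp" and t: "t > 0"
  shows "ennreal (t powr - N / C) * lp_diff p m f t \<le> lp_avg_diff p m f t"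
proof -
  note [measurable] = Lp_measurable[OF f]
  have "ennreal (t powr - N / C) * lp_diff p m f t =
      (\<integral>\<^sup>+x. ennreal (t powr - N / C) * (\<integral>\<^sup>+y. near t x y * ennreal (\<bar>f y - f x\<bar> powr p) \<partial>m) \<partial>m)"
    unfolding lp_diff_def by (simp add: nn_integral_cmult abs_minus_commute)
  also have "\<dots> \<le> lp_avg_diff p m f t"
    unfolding lp_avg_diff_def
  proof (intro nn_integral_mono mult_right_mono)
    fix x
    have "ennreal (t powr - N / C) = 1 / ennreal (C * t powr N)"
      using t pos divide_ennreal[of 1 "C * t powr N"] by (simp add: powr_minus field_simps)
    also have "\<dots> \<le> 1 / emeasure m (ball x t)"
      by (intro ennreal_divide_antimono m_upper t)
    finally show "ennreal (t powr - N / C) \<le> 1 / emeasure m (ball x t)" .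
  qed auto
  finally show ?thesis .
qed

text \<open>The exponent is that of \<open>bseq\<close>, and 8 is the largest ratio of
  \<open>t\<close> to \<open>(1 / 2) ^ k\<close> on the interval of index \<open>k\<close>.\<close>

definition \<kappa> :: real where "\<kappa> = 8 powr - (N + \<alpha> * p) / C"

lemma \<kappa>: "\<kappa> > 0" using pos by (simp add: \<kappa>_def)

lemma bseq_le_besov_term:
  assumes f: "f \<in> Lp" and t: "4 * (1 / 2) ^ k < t" "t \<le> 8 * (1 / 2) ^ k"
  shows "ennreal (\<kappa> powr (q / p)) * ennpowr (bseq f k) (q / p) \<le> ennpowr (ennreal (t powr (- \<alpha>)) * besov_E p m f t) q"
proof -
  let ?r = "(1 / 2 :: real) ^ k" and ?e = "N + \<alpha> * p"
  have e: "?e > 0" using \<alpha>N p by (simp add: add_pos_pos)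
  have t0: "t > 0" using t(1) by (rule less_trans[rotated]) simp
  have "ennreal \<kappa> * bseq f k = ennreal (\<kappa> * ?r powr - ?e) * lp_diff p m f (4 * ?r)"
    using \<kappa> by (simp add: bseq_def ennreal_mult mult.assoc)
  also have "\<dots> \<le> ennreal (t powr - (\<alpha> * p) * (t powr - N / C)) * lp_diff p m f t"
  proof (rule mult_mono[OF ennreal_leI lp_diff_mono])
    have "\<kappa> * ?r powr - ?e = (8 * ?r) powr - ?e / C"
      unfolding \<kappa>_def by (simp add: powr_mult)
    also have "\<dots> \<le> t powr - ?e / C"
      using t t0 e pos by (intro divide_right_mono powr_mono2') auto
    also have "\<dots> = t powr - (\<alpha> * p) * (t powr - N / C)"
      by (simp add: powr_add[symmetric] algebra_simps)
    finally show "\<kappa> * ?r powr - ?e \<le> t powr - (\<alpha> * p) * (t powr - N / C)" .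
  qed (use t in auto)
  also have "\<dots> = ennreal (t powr - (\<alpha> * p)) * (ennreal (t powr - N / C) * lp_diff p m f t)"
    using pos by (subst ennreal_mult) (auto simp: mult.assoc)
  also have "\<dots> \<le> ennreal (t powr - (\<alpha> * p)) * lp_avg_diff p m f t"
    by (intro mult_left_mono lp_avg_diff_ge f t0) auto
  finally have "ennpowr (ennreal \<kappa> * bseq f k) (q / p) \<le> ennpowr (ennreal (t powr - (\<alpha> * p)) * lp_avg_diff p m f t) (q / p)"
    using p q by (intro ennpowr_mono) auto
  then show ?thesis
    using p q t0 \<kappa> by (simp add: besov_E_eq ennpowr_besov_term) (simp add: ennpowr_mult ennpowr_ennreal)
qed

definition c4 :: real where "c4 = 2 / \<kappa> powr (q / p)"

lemma sum_bseq_le: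
  assumes f: "f \<in> Lp"
  shows "(\<Sum>k. ennpowr (bseq f k) (q / p)) \<le> ennreal c4 * besov_integral \<alpha> p q m f"
proof -
  let ?c = "\<kappa> powr (q / p)"
  have c: "?c > 0" using \<kappa> by simp
  have "ennreal ?c * (\<Sum>k. ennpowr (bseq f k) (q / p)) = (\<Sum>k. ennreal ?c * ennpowr (bseq f k) (q / p))"
    by simp
  also have "\<dots> \<le> 2 * besov_integral \<alpha> p q m f"
    unfolding besov_integral_def by (intro dyadic_sum_le_nn_integral bseq_le_besov_term f)
  finally have "ennreal (1 / ?c) * (ennreal ?c * (\<Sum>k. ennpowr (bseq f k) (q / p))) \<le> ennreal (1 / ?c) * (2 * besov_integral \<alpha> p q m f)"
    by (intro mult_left_mono) auto
  moreover have "ennreal (1 / ?c) * ennreal ?c = 1"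
    using c by (subst ennreal_mult[symmetric]) auto
  moreover have "ennreal (1 / ?c) * 2 = ennreal c4"
    using c ennreal_mult[of "1 / ?c" 2] by (simp add: c4_def)
  ultimately show ?thesis
    by (simp add: mult.assoc[symmetric])
qed

lemma c4: "c4 > 0" using \<kappa> by (simp add: c4_def)

lemma sum_btail_le:
  obtains c where "c > 0"
    "\<And>f. f \<in> Lp \<Longrightarrow> (\<Sum>k. ennpowr (btail f k) (q / p)) \<le> ennreal c * besov_integral \<alpha> p q m f"
proof -
  obtain h where h: "h > 0"
    "\<And>b :: nat \<Rightarrow> ennreal. (\<Sum>k. ennpowr (\<Sum>i. ennreal (\<rho> ^ i) * b (k + i)) (q / p)) \<le> ennreal h * (\<Sum>k. ennpowr (b k) (q / p))"
    using hardy_geometric[OF \<rho>, of "q / p"] p q by auto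
  show ?thesis
  proof (rule that)
    show "h * c4 > 0" using h c4 by simp
    fix f assume f: "f \<in> Lp"
    have "(\<Sum>k. ennpowr (btail f k) (q / p)) \<le> ennreal h * (\<Sum>k. ennpowr (bseq f k) (q / p))"
      unfolding btail_def by (rule h)
    also have "\<dots> \<le> ennreal h * (ennreal c4 * besov_integral \<alpha> p q m f)"
      by (intro mult_left_mono sum_bseq_le f) auto
    finally show "(\<Sum>k. ennpowr (btail f k) (q / p)) \<le> ennreal (h * c4) * besov_integral \<alpha> p q m f"
      using h c4 by (simp add: ennreal_mult mult.assoc)
  qed
qed

text \<open>As \<open>t > (1 / 2) ^ Suc k\<close>, the weight is at most
  \<open>\<rho> ^ Suc k\<close> to the power -p; against the factor
  \<open>(\<rho> ^ k) powr p\<close> of the single-scale bound only \<open>\<rho> powr - p\<close>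
  survives.\<close>

lemma trace_besov_term_le:
  assumes f: "f \<in> Lp" and t: "0 < t" "(1 / 2) ^ Suc k < t" "t \<le> (1 / 2) ^ k"
  shows "ennpowr (ennreal (t powr (- \<beta>)) * besov_E p \<mu> (trace_op m f) t) q \<le>
    ennreal ((c3 / \<rho> powr p) powr (q / p)) * ennpowr (btail f k) (q / p)"
proof -
  let ?s = "(1 / 2 :: real) ^ Suc k"
  have "ennreal (t powr - (\<beta> * p)) * lp_avg_diff p \<mu> (trace_op m f) t \<le>
      ennreal (?s powr - (\<beta> * p)) * (ennreal (c3 * (\<rho> ^ k) powr p) * btail f k)"
    using t \<beta>(1) p by (intro mult_mono ennreal_leI powr_mono2' lp_avg_diff_trace_le f) auto
  also have "\<dots> = ennreal (?s powr - (\<beta> * p) * (c3 * (\<rho> ^ k) powr p)) * btail f k"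
    using c3 by (subst ennreal_mult) (auto simp: mult.assoc)
  also have "?s powr - (\<beta> * p) * (c3 * (\<rho> ^ k) powr p) = c3 / \<rho> powr p"
  proof -
    have "?s powr - (\<beta> * p) = 1 / (\<rho> ^ Suc k) powr p"
      by (simp only: half_power_powr[symmetric] powr_minus inverse_eq_divide)
    then show ?thesis using \<rho> by (simp add: powr_mult)
  qed
  finally have "ennpowr (ennreal (t powr - (\<beta> * p)) * lp_avg_diff p \<mu> (trace_op m f) t) (q / p) \<le>
      ennpowr (ennreal (c3 / \<rho> powr p) * btail f k) (q / p)"
    using p q by (intro ennpowr_mono) auto
  then show ?thesis
    using p q t c3 \<rho> by (simp add: besov_E_eq ennpowr_besov_term) (simp add: ennpowr_mult ennpowr_ennreal)
qed

text \<open>Comparison with the average at radius 1: its p-th power is at most \<open>C\<close>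
  times the integral of \<open>\<bar>f y\<bar> powr p\<close> over a unit ball, and after Tonelli
  the \<mu>-mass of a unit ball is at most \<open>K\<close>.\<close>

lemma nn_integral_trace_le:
  assumes f: "f \<in> Lp"
  shows "(\<integral>\<^sup>+x. ennreal (\<bar>trace_op m f x\<bar> powr p) \<partial>\<mu>) \<le>
    ennreal (4 powr p) * (ennreal c2 * btail f 0 + ennreal (C * K) * (\<integral>\<^sup>+x. ennreal (\<bar>f x\<bar> powr p) \<partial>m))"
proof -
  note [measurable] = Lp_measurable[OF f] Lp_trace_measurable[OF f]
  let ?A = "avg m ((1 / 2) ^ 0) f" and ?h = "\<lambda>y. ennreal (\<bar>f y\<bar> powr p)"
  have "(\<integral>\<^sup>+x. ennreal (\<bar>?A x\<bar> powr p) \<partial>\<mu>) \<le> (\<integral>\<^sup>+x. ennreal C * (\<integral>\<^sup>+y. near 1 x y * ?h y \<partial>m) \<partial>\<mu>)"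
    using avg_diff_powr_le[OF f, of 1 0] by (intro nn_integral_mono) simp
  also have "\<dots> = ennreal C * (\<integral>\<^sup>+x. \<integral>\<^sup>+y. near 1 x y * ?h y \<partial>m \<partial>\<mu>)"
    by (simp add: nn_integral_cmult)
  also have "(\<integral>\<^sup>+x. \<integral>\<^sup>+y. near 1 x y * ?h y \<partial>m \<partial>\<mu>) = (\<integral>\<^sup>+y. \<integral>\<^sup>+x. near 1 x y * ?h y \<partial>\<mu> \<partial>m)"
    by (rule pair_sigma_finite.Fubini'[OF pair_sigma_finite(1), symmetric]) measurable
  also have "\<dots> = (\<integral>\<^sup>+y. emeasure \<mu> (ball y 1) * ?h y \<partial>m)"
    by (simp add: nn_integral_multc near_commute[of 1 _ "_ :: 'a"] flip: nn_integral_near(2))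
  also have "\<dots> \<le> (\<integral>\<^sup>+y. ennreal K * ?h y \<partial>m)"
    using \<mu>_upper[of 1] by (intro nn_integral_mono mult_right_mono) auto
  also have "\<dots> = ennreal K * (\<integral>\<^sup>+y. ?h y \<partial>m)"
    by (simp add: nn_integral_cmult measurable_cong_sets[OF sets_m refl])
  finally have A: "(\<integral>\<^sup>+x. ennreal (\<bar>?A x\<bar> powr p) \<partial>\<mu>) \<le> ennreal (C * K) * (\<integral>\<^sup>+y. ?h y \<partial>m)"
    using pos by (simp add: ennreal_mult mult_left_mono mult.assoc)
  have "(\<integral>\<^sup>+x. ennreal (\<bar>trace_op m f x\<bar> powr p) \<partial>\<mu>) \<le>
      (\<integral>\<^sup>+x. ennreal (4 powr p) * (ennreal (\<bar>trace_op m f x - ?A x\<bar> powr p) + ennreal (\<bar>?A x\<bar> powr p)) \<partial>\<mu>)"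
  proof (rule nn_integral_mono)
    fix x
    show "ennreal (\<bar>trace_op m f x\<bar> powr p) \<le> ennreal (4 powr p) * (ennreal (\<bar>trace_op m f x - ?A x\<bar> powr p) + ennreal (\<bar>?A x\<bar> powr p))"
      using powr_add3_le[of p "trace_op m f x" 0 "?A x" 0] p by simp
  qed
  also have "\<dots> = ennreal (4 powr p) * ((\<integral>\<^sup>+x. ennreal (\<bar>trace_op m f x - ?A x\<bar> powr p) \<partial>\<mu>) + (\<integral>\<^sup>+x. ennreal (\<bar>?A x\<bar> powr p) \<partial>\<mu>))"
    by (simp add: nn_integral_cmult nn_integral_add)
  also have "\<dots> \<le> ennreal (4 powr p) * (ennreal c2 * btail f 0 + ennreal (C * K) * (\<integral>\<^sup>+x. ?h x \<partial>m))"
    using nn_integral_trace_diff_le[OF f, of 0] by (intro mult_left_mono add_mono A) auto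
  finally show ?thesis .
qed

text \<open>Scales up to 1 go through the dyadic sum. For larger ones \<open>lp_avg_diff_le\<close>
  leaves the weight \<open>t powr - (\<beta> * q)\<close>, whose integral for dt/t over
  \<open>t > 1\<close> is \<open>1 / (\<beta> * q)\<close>.\<close>

lemma besov_integral_trace_le:
  assumes f: "f \<in> Lp"
  shows "besov_integral \<beta> p q \<mu> (trace_op m f) \<le>
    ennreal ((c3 / \<rho> powr p) powr (q / p)) * (\<Sum>k. ennpowr (btail f k) (q / p)) +
    ennreal (1 / (\<beta> * q)) * ennpowr (ennreal (4 powr p * (1 + E)) * (\<integral>\<^sup>+x. ennreal (\<bar>trace_op m f x\<bar> powr p) \<partial>\<mu>)) (q / p)"
proof -
  note [measurable] = Lp_trace_measurable[OF f]
  let ?B = "ennreal (4 powr p * (1 + E)) * (\<integral>\<^sup>+x. ennreal (\<bar>trace_op m f x\<bar> powr p) \<partial>\<mu>)"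
  have "besov_integral \<beta> p q \<mu> (trace_op m f) \<le>
    (\<Sum>k. ennreal ((c3 / \<rho> powr p) powr (q / p)) * ennpowr (btail f k) (q / p)) + ennreal (1 / (\<beta> * q)) * ennpowr ?B (q / p)"
    unfolding besov_integral_def
  proof (rule nn_integral_le_dyadic_sum)
    show "\<beta> * q > 0" using \<beta>(1) q by simp
    fix t :: real assume t: "1 < t"
    have "ennpowr (ennreal (t powr (- \<beta>)) * besov_E p \<mu> (trace_op m f) t) q =
        ennpowr (ennreal (t powr - (\<beta> * p)) * lp_avg_diff p \<mu> (trace_op m f) t) (q / p)"
      using p q t by (simp add: besov_E_eq ennpowr_besov_term)
    also have "\<dots> \<le> ennpowr (ennreal (t powr - (\<beta> * p)) * ?B) (q / p)"
      using p q t by (intro ennpowr_mono mult_left_mono lp_avg_diff_le) auto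
    also have "\<dots> = ennreal (t powr - (\<beta> * q)) * ennpowr ?B (q / p)"
      using p q by (simp add: ennpowr_mult[of "q / p" "ennreal (t powr - (\<beta> * p))"] ennpowr_ennreal powr_powr)
    finally show "ennpowr (ennreal (t powr (- \<beta>)) * besov_E p \<mu> (trace_op m f) t) q \<le> ennreal (t powr - (\<beta> * q)) * ennpowr ?B (q / p)" .
  qed (rule trace_besov_term_le[OF f])
  then show ?thesis by simp
qed

end


section \<open>Boundedness of the trace operator\<close>

text \<open>Packing: an \<open>e\<close>-separated set in a ball gives disjoint balls of radius
  \<open>e / 2\<close> inside a larger ball of finite mass, each of mass at least \<open>c\<close>,
  so its cardinality is bounded. One of largest cardinality is an \<open>e\<close>-net, since a
  point far from it could be added. Nets for countably many balls and scales are united.\<close>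

lemma countable_dense_if_ball_bounds:
  fixes m :: "'a::metric_space measure"
  assumes sets: "sets m = sets borel"
    and upper: "\<And>x r. r > 0 \<Longrightarrow> emeasure m (ball x r) < \<infinity>"
    and lower: "\<And>r. r > 0 \<Longrightarrow> \<exists>c>0. \<forall>x. ennreal c \<le> emeasure m (ball x r)"
  obtains D :: "'a set" where "countable D" "\<And>x e. e > 0 \<Longrightarrow> \<exists>d\<in>D. dist x d < e"
proof -
  let ?x0 = "undefined :: 'a"
  have net: "\<exists>A. finite A \<and> (\<forall>x\<in>ball ?x0 R. \<exists>a\<in>A. dist x a < e)" if R: "R > 0" and e: "e > 0" for R e :: real
  proof -
    obtain c where c: "c > 0" "\<And>x. ennreal c \<le> emeasure m (ball x (e / 2))"
      using lower[of "e / 2"] e by auto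
    obtain B where B: "emeasure m (ball ?x0 (R + e)) = ennreal B" "B \<ge> 0"
      using upper[of "R + e" ?x0] R e by (cases "emeasure m (ball ?x0 (R + e))") auto
    define S where "S = {A. finite A \<and> A \<subseteq> ball ?x0 R \<and> (\<forall>a\<in>A. \<forall>b\<in>A. a \<noteq> b \<longrightarrow> e \<le> dist a b)}"
    have bound: "card A \<le> nat \<lceil>B / c\<rceil>" if A: "A \<in> S" for A
    proof -
      have "disjoint_family_on (\<lambda>a. ball a (e / 2)) A"
        unfolding disjoint_family_on_def
      proof (intro ballI impI)
        fix a b assume "a \<in> A" "b \<in> A" "a \<noteq> b"
        then have "e \<le> dist a b" using A by (auto simp: S_def)
        then show "ball a (e / 2) \<inter> ball b (e / 2) = {}"
          by (intro disjoint_ballI) simp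
      qed
      then have "(\<Sum>a\<in>A. emeasure m (ball a (e / 2))) = emeasure m (\<Union>a\<in>A. ball a (e / 2))"
        using A by (intro sum_emeasure) (auto simp: sets S_def)
      also have "\<dots> \<le> emeasure m (ball ?x0 (R + e))"
      proof (rule emeasure_mono)
        show "(\<Union>a\<in>A. ball a (e / 2)) \<subseteq> ball ?x0 (R + e)"
        proof safe
          fix a x assume "a \<in> A" "x \<in> ball a (e / 2)"
          then have "dist ?x0 a < R" "dist a x < e / 2" using A by (auto simp: S_def)
          then show "x \<in> ball ?x0 (R + e)" using dist_triangle[of ?x0 x a] e by simp
        qed
      qed (simp add: sets)
      finally have "(\<Sum>a\<in>A. emeasure m (ball a (e / 2))) \<le> ennreal B" using B by simp
      moreover have "(\<Sum>a\<in>A. ennreal c) \<le> (\<Sum>a\<in>A. emeasure m (ball a (e / 2)))"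
        by (intro sum_mono c)
      ultimately have "(\<Sum>a\<in>A. ennreal c) \<le> ennreal B" by simp
      then have "real (card A) * c \<le> B"
        using c B by (simp add: ennreal_of_nat_eq_real_of_nat flip: ennreal_mult)
      then have "real (card A) \<le> B / c" using c by (simp add: field_simps)
      then show ?thesis by linarith
    qed
    have "{} \<in> S" by (simp add: S_def)
    then obtain A where A: "A \<in> S" "\<And>A'. A' \<in> S \<Longrightarrow> card A' \<le> card A"
      using ex_has_greatest_nat[of "\<lambda>A. A \<in> S" "{}" card "Suc (nat \<lceil>B / c\<rceil>)"] bound
      by (auto simp: less_Suc_eq_le)
    have "\<exists>a\<in>A. dist x a < e" if x: "x \<in> ball ?x0 R" for x
    proof (rule ccontr)
      assume *: "\<not> ?thesis"
      then have far: "e \<le> dist x a" "e \<le> dist a x" if "a \<in> A" for a using that by (auto simp: not_less dist_commute)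
      have "x \<notin> A" using * e by auto
      moreover have "insert x A \<in> S" using A(1) x far by (auto simp: S_def)
      ultimately show False using A(2)[of "insert x A"] A(1) by (auto simp: S_def)
    qed
    then show ?thesis using A(1) by (auto simp: S_def)
  qed
  then have "\<forall>n k. \<exists>A. finite A \<and> (\<forall>x\<in>ball ?x0 (real n + 1). \<exists>a\<in>A. dist x a < 1 / (real k + 1))"
    by simp
  then obtain A where A: "\<And>n k. finite (A n k)"
    "\<And>n k x. x \<in> ball ?x0 (real n + 1) \<Longrightarrow> \<exists>a\<in>A n k. dist x a < 1 / (real k + 1)"
    by metis
  show ?thesis
  proof (rule that)
    show "countable (\<Union>n k. A n k)" by (intro countable_UN countableI_type countable_finite A(1))
    fix x :: 'a and e :: real assume "e > 0"
    obtain n :: nat where "dist ?x0 x < real n" using reals_Archimedean2 by blast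
    then have "x \<in> ball ?x0 (real n + 1)" by simp
    obtain k :: nat where "1 / (real k + 1) < e"
      using reals_Archimedean[OF \<open>e > 0\<close>] by (auto simp: inverse_eq_divide add.commute)
    with A(2)[OF \<open>x \<in> _\<close>, of k] show "\<exists>d\<in>\<Union>n k. A n k. dist x d < e"
      by (auto intro: less_trans)
  qed
qed

lemma dist_le_ediam: "x \<in> Y \<Longrightarrow> y \<in> Y \<Longrightarrow> ennreal (dist x y) \<le> ediam Y"
  unfolding ediam_def by (intro SUP_upper2[of x] SUP_upper2[of y]) auto

text \<open>\<open>ahlfors_regular\<close> bounds only balls of radius below twice the diameter. The
  upper bound extends to larger ones, because they contain the whole space and this is already an
  admissible ball.\<close>

lemma ahlfors_regular_ball_bounds:
  assumes "ahlfors_regular M \<nu>"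
  shows "\<exists>c>0. (\<forall>x\<in>space \<nu>. \<forall>r>0. emeasure \<nu> (ball x r \<inter> space \<nu>) \<le> ennreal (c * r powr M)) \<and>
    (\<forall>x\<in>space \<nu>. \<forall>r>0. ennreal r < ediam (space \<nu>) \<longrightarrow>
      ennreal (r powr M / c) \<le> emeasure \<nu> (ball x (2 * r) \<inter> space \<nu>))"
proof -
  let ?Y = "space \<nu>"
  obtain c where c: "c > 0" and M: "M > 0" and diam: "ediam ?Y > 0" and
    b: "\<And>x r. x \<in> ?Y \<Longrightarrow> r > 0 \<Longrightarrow> ennreal r < ediam ?Y \<Longrightarrow>
        ennreal (r powr M / c) \<le> emeasure \<nu> (ball x (2 * r) \<inter> ?Y) \<and>
        emeasure \<nu> (ball x (2 * r) \<inter> ?Y) \<le> ennreal (c * r powr M)"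
    using assms unfolding ahlfors_regular_def by blast
  have "emeasure \<nu> (ball x r \<inter> ?Y) \<le> ennreal (c * r powr M)" if x: "x \<in> ?Y" and r: "r > 0" for x r
  proof (cases "ennreal (r / 2) < ediam ?Y")
    case True
    then have "emeasure \<nu> (ball x r \<inter> ?Y) \<le> ennreal (c * (r / 2) powr M)"
      using b[OF x, of "r / 2"] r by simp
    also have "\<dots> \<le> ennreal (c * r powr M)"
      using r M c by (intro ennreal_leI mult_left_mono powr_mono2) auto
    finally show ?thesis .
  next
    case False
    then obtain d where d: "ediam ?Y = ennreal d" "0 < d" "d \<le> r / 2"
      using diam r by (cases "ediam ?Y") (auto simp: top_unique ennreal_less_iff not_less)
    have "dist x y \<le> d" if "y \<in> ?Y" for y
      using dist_le_ediam[OF x that] d by simp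
    \<comment> \<open>Any factor strictly between 1/2 and 1 would do: \<open>3 * d / 4\<close> is
      below the diameter \<open>d\<close>, and its double exceeds \<open>d\<close>.\<close>
    then have "ball x r \<inter> ?Y = ball x (2 * (3 * d / 4)) \<inter> ?Y"
      using d r by force
    also have "emeasure \<nu> \<dots> \<le> ennreal (c * (3 * d / 4) powr M)"
      using b[OF x, of "3 * d / 4"] d by (auto simp: ennreal_less_iff)
    also have "\<dots> \<le> ennreal (c * r powr M)"
      using d M c by (intro ennreal_leI mult_left_mono powr_mono2) auto
    finally show ?thesis .
  qed
  with c b show ?thesis by (intro exI[of _ c]) auto
qed

lemma besov_norm_cong_AE:
  assumes "AE x in \<nu>. u x = v x"
  shows "besov_norm \<alpha> p q \<nu> u = besov_norm \<alpha> p q \<nu> v"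
proof -
  have "lp_norm p \<nu> u = lp_norm p \<nu> v"
    unfolding lp_norm_def by (intro arg_cong2[of _ _ _ _ ennpowr] nn_integral_cong_AE) (use assms in auto)
  moreover have "besov_E p \<nu> u t = besov_E p \<nu> v t" for t
  proof -
    have "(\<integral>\<^sup>+y\<in>ball x t. ennreal (\<bar>u y - c\<bar> powr p) \<partial>\<nu>) = (\<integral>\<^sup>+y\<in>ball x t. ennreal (\<bar>v y - c\<bar> powr p) \<partial>\<nu>)" for x c
      using assms by (intro nn_integral_cong_AE) auto
    then show ?thesis
      unfolding besov_E_def using assms by (intro arg_cong2[of _ _ _ _ ennpowr] nn_integral_cong_AE) auto
  qed
  ultimately show ?thesis by (simp add: besov_norm_def)
qed

text \<open>As \<open>F\<close> has full measure, the restriction changes no integral and no mass of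
  a ball; the estimates can therefore be carried out on the whole type.\<close>

lemma besov_norm_restrict_space:
  assumes "space \<nu> = UNIV" "F \<in> sets \<nu>" and F: "AE x in \<nu>. x \<in> F"
    and balls: "\<And>x r. ball x r \<in> sets \<nu>"
  shows "besov_norm \<alpha> p q (restrict_space \<nu> F) u = besov_norm \<alpha> p q \<nu> u"
proof -
  have int: "(\<integral>\<^sup>+x. g x \<partial>restrict_space \<nu> F) = (\<integral>\<^sup>+x. g x \<partial>\<nu>)" for g
    using assms F by (subst nn_integral_restrict_space) (auto intro!: nn_integral_cong_AE)
  have "emeasure (restrict_space \<nu> F) (ball x r \<inter> F) = emeasure \<nu> (ball x r)" for x r
    using assms F balls[of x r] by (subst emeasure_restrict_space) (auto intro!: emeasure_eq_AE)
  then show ?thesis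
    using assms(1) by (simp add: besov_norm_def lp_norm_def besov_E_def int space_restrict_space)
qed

context besov_trace_setting
begin

lemma besov_norm_eq: "space \<nu> = UNIV \<Longrightarrow> besov_norm a p q \<nu> f =
    ennpowr (\<integral>\<^sup>+x. ennreal (\<bar>f x\<bar> powr p) \<partial>\<nu>) (1 / p) + ennpowr (besov_integral a p q \<nu> f) (1 / q)"
  by (simp add: besov_norm_def lp_norm_def besov_integral_def)

text \<open>The second estimate is what yields convergence of the averages almost everywhere. All
  bounds are first expressed by p-th or q-th powers of the norm of \<open>f\<close>, and the roots
  are taken at the end.\<close>

lemma besov_norm_trace_le:
  "\<exists>c>0. \<forall>f\<in>Lp. besov_norm \<beta> p q \<mu> (trace_op m f) \<le> ennreal c * besov_norm \<alpha> p q m f \<and>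
    btail f 0 \<le> ennreal c * ennpowr (besov_norm \<alpha> p q m f) p"
proof -
  obtain b where b: "b > 0"
    "\<And>f. f \<in> Lp \<Longrightarrow> (\<Sum>k. ennpowr (btail f k) (q / p)) \<le> ennreal b * besov_integral \<alpha> p q m f"
    using sum_btail_le by blast
  \<comment> \<open>\<open>a\<close> will bound the integral of the p-th power of the trace by the
    p-th power of the norm of \<open>f\<close>, and \<open>d\<close> the Besov integral of the trace
    by the q-th power.\<close>
  define a where "a = 4 powr p * (c2 * b powr (p / q) + C * K)"
  define A1 where "A1 = (c3 / \<rho> powr p) powr (q / p)"
  define c6 where "c6 = 4 powr p * (1 + E)"
  define d where "d = A1 * b + 1 / (\<beta> * q) * (c6 * a) powr (q / p)"
  have pq: "p > 0" "q > 0" using p q by auto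
  have a: "a > 0" using c2 pos by (auto simp: a_def intro!: mult_pos_pos add_nonneg_pos)
  have A1: "A1 \<ge> 0" by (simp add: A1_def)
  have c6: "c6 > 0" using pos by (simp add: c6_def)
  have d: "d \<ge> 0" using A1 b pq \<beta>(1) by (simp add: d_def)
  define c where "c = a powr (1 / p) + d powr (1 / q) + b powr (p / q)"
  show ?thesis
  proof (intro exI[of _ c] conjI ballI)
    show "c > 0" using a b by (auto simp: c_def intro!: add_nonneg_pos)
    fix f assume f: "f \<in> Lp"
    let ?n = "besov_norm \<alpha> p q m f"
    let ?I = "\<integral>\<^sup>+x. ennreal (\<bar>f x\<bar> powr p) \<partial>m" and ?J = "besov_integral \<alpha> p q m f"
    let ?IF = "\<integral>\<^sup>+x. ennreal (\<bar>trace_op m f x\<bar> powr p) \<partial>\<mu>" and ?JF = "besov_integral \<beta> p q \<mu> (trace_op m f)"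
    have I: "?I \<le> ennpowr ?n p"
      using ennpowr_le_iff[of "1 / p" ?I ?n] pq by (simp add: besov_norm_eq)
    have J: "?J \<le> ennpowr ?n q"
      using ennpowr_le_iff[of "1 / q" ?J ?n] pq by (simp add: besov_norm_eq)
    have sum: "(\<Sum>k. ennpowr (btail f k) (q / p)) \<le> ennreal b * ennpowr ?n q"
      by (rule order_trans[OF b(2)[OF f]]) (intro mult_left_mono J, simp)
    \<comment> \<open>\<open>btail f 0\<close> enters as one term of the summed sequence.\<close>
    have "ennpowr (btail f 0) (q / p) \<le> (\<Sum>k. ennpowr (btail f k) (q / p))"
      using sum_le_suminf[OF summableI, of "{0}" "\<lambda>k. ennpowr (btail f k) (q / p)"] by simp
    also note sum
    finally have "btail f 0 \<le> ennpowr (ennreal b * ennpowr ?n q) (p / q)"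
      using pq by (simp add: ennpowr_le_iff)
    also have "\<dots> = ennreal (b powr (p / q)) * ennpowr ?n p"
      using pq b by (simp add: ennpowr_mult ennpowr_ennreal ennpowr_ennpowr)
    finally have bt: "btail f 0 \<le> ennreal (b powr (p / q)) * ennpowr ?n p" .
    also have "\<dots> \<le> ennreal c * ennpowr ?n p"
      by (intro mult_right_mono ennreal_leI) (auto simp: c_def)
    finally show "btail f 0 \<le> ennreal c * ennpowr ?n p" .
    have "?IF \<le> ennreal (4 powr p) * (ennreal c2 * (ennreal (b powr (p / q)) * ennpowr ?n p) + ennreal (C * K) * ennpowr ?n p)"
      by (rule order_trans[OF nn_integral_trace_le[OF f]]) (intro mult_left_mono add_mono bt I; simp)
    also have "\<dots> = ennreal a * ennpowr ?n p"
    proof -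
      have "ennreal a = ennreal (4 powr p) * (ennreal c2 * ennreal (b powr (p / q)) + ennreal (C * K))"
        unfolding a_def using pos c2
        by (subst ennreal_mult, simp, simp, subst ennreal_plus, simp, simp, subst ennreal_mult, simp_all)
      then show ?thesis by (simp only: distrib_right mult.assoc)
    qed
    finally have IF: "?IF \<le> ennreal a * ennpowr ?n p" .
    then have "ennpowr ?IF (1 / p) \<le> ennpowr (ennreal a * ennpowr ?n p) (1 / p)"
      using pq by (intro ennpowr_mono) auto
    also have "\<dots> = ennreal (a powr (1 / p)) * ?n"
      using pq a by (simp add: ennpowr_mult ennpowr_ennreal ennpowr_ennpowr)
    finally have 1: "ennpowr ?IF (1 / p) \<le> ennreal (a powr (1 / p)) * ?n" .
    have "?JF \<le> ennreal A1 * (ennreal b * ennpowr ?n q) + ennreal (1 / (\<beta> * q)) * ennpowr (ennreal c6 * (ennreal a * ennpowr ?n p)) (q / p)"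
      by (rule order_trans[OF besov_integral_trace_le[OF f, folded A1_def c6_def]])
        (intro add_mono mult_left_mono ennpowr_mono sum IF; use pq in simp)
    also have "ennpowr (ennreal c6 * (ennreal a * ennpowr ?n p)) (q / p) = ennreal ((c6 * a) powr (q / p)) * ennpowr ?n q"
      using pq a c6 by (simp add: ennpowr_mult ennpowr_ennreal ennpowr_ennpowr powr_mult ennreal_mult mult.assoc)
    also have "ennreal A1 * (ennreal b * ennpowr ?n q) + ennreal (1 / (\<beta> * q)) * (ennreal ((c6 * a) powr (q / p)) * ennpowr ?n q) =
      ennreal d * ennpowr ?n q"
    proof -
      have "ennreal d = ennreal A1 * ennreal b + ennreal (1 / (\<beta> * q)) * ennreal ((c6 * a) powr (q / p))"
        unfolding d_def using A1 b pq \<beta>(1)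
        by (subst ennreal_plus, simp, simp, subst (1 2) ennreal_mult, simp_all)
      then show ?thesis by (simp only: distrib_right mult.assoc)
    qed
    finally have "ennpowr ?JF (1 / q) \<le> ennpowr (ennreal d * ennpowr ?n q) (1 / q)"
      using pq by (intro ennpowr_mono) auto
    also have "\<dots> = ennreal (d powr (1 / q)) * ?n"
      using pq d by (simp add: ennpowr_mult ennpowr_ennreal ennpowr_ennpowr)
    finally have 2: "ennpowr ?JF (1 / q) \<le> ennreal (d powr (1 / q)) * ?n" .
    have "besov_norm \<beta> p q \<mu> (trace_op m f) \<le> ennreal (a powr (1 / p)) * ?n + ennreal (d powr (1 / q)) * ?n"
      using add_mono[OF 1 2] by (simp add: besov_norm_eq)
    also have "\<dots> = ennreal (a powr (1 / p) + d powr (1 / q)) * ?n"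
      by (simp add: distrib_right ennreal_plus)
    also have "\<dots> \<le> ennreal c * ?n"
      by (intro mult_right_mono ennreal_leI) (auto simp: c_def)
    finally show "besov_norm \<beta> p q \<mu> (trace_op m f) \<le> ennreal c * ?n" .
  qed
qed

lemma besov_space_subset_Lp:
  assumes "f \<in> besov_space \<alpha> p q m" shows "f \<in> Lp"
proof -
  have "ennpowr (\<integral>\<^sup>+x. ennreal (\<bar>f x\<bar> powr p) \<partial>m) (1 / p) < \<infinity>"
    using assms by (auto simp: besov_space_def besov_norm_eq ennreal_add_less_top)
  then have "(\<integral>\<^sup>+x. ennreal (\<bar>f x\<bar> powr p) \<partial>m) < \<infinity>"
    by (cases "\<integral>\<^sup>+x. ennreal (\<bar>f x\<bar> powr p) \<partial>m") auto
  then show ?thesis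
    using assms by (auto simp: Lp_def besov_space_def measurable_cong_sets[OF sets_m refl])
qed

lemma AE_convergent_avg_besov:
  assumes "f \<in> besov_space \<alpha> p q m"
  shows "AE x in \<mu>. convergent (\<lambda>k. avg m ((1 / 2) ^ k) f x)"
proof (rule AE_convergent_avg)
  show f: "f \<in> Lp" by (rule besov_space_subset_Lp[OF assms])
  obtain c where c: "c > 0"
    "\<And>f. f \<in> Lp \<Longrightarrow> besov_norm \<beta> p q \<mu> (trace_op m f) \<le> ennreal c * besov_norm \<alpha> p q m f"
    "\<And>f. f \<in> Lp \<Longrightarrow> btail f 0 \<le> ennreal c * ennpowr (besov_norm \<alpha> p q m f) p"
    using besov_norm_trace_le by blast
  have "btail f 0 \<le> ennreal c * ennpowr (besov_norm \<alpha> p q m f) p"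
    by (rule c(3)[OF f])
  also have "\<dots> < \<infinity>"
    using assms by (cases "besov_norm \<alpha> p q m f") (auto simp: besov_space_def ennreal_mult_less_top ennpowr_def)
  finally show "btail f 0 < \<infinity>" .
qed

section \<open>Linearity of the averages and values at continuous functions\<close>

lemma avg_add: "f \<in> Lp \<Longrightarrow> g \<in> Lp \<Longrightarrow> avg m r (\<lambda>y. f y + g y) x = avg m r f x + avg m r g x"
  by (simp add: avg_def set_integral_add Lp_set_integrable add_divide_distrib)

lemma avg_diff: "f \<in> Lp \<Longrightarrow> g \<in> Lp \<Longrightarrow> avg m r (\<lambda>y. f y - g y) x = avg m r f x - avg m r g x"
  by (simp add: avg_def set_integral_diff Lp_set_integrable diff_divide_distrib)

lemma avg_scale: "avg m r (\<lambda>y. c * f y) x = c * avg m r f x"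
  by (simp add: avg_def)

text \<open>The mean over a small ball differs from the value at the centre by at most the
  oscillation of \<open>f\<close> there, so the identity holds at every point.\<close>

lemma trace_op_continuous:
  assumes f: "f \<in> Lp" and cont: "continuous_on UNIV f"
  shows "trace_op m f x = f x"
proof -
  have "(\<lambda>k. avg m ((1 / 2) ^ k) f x) \<longlonglongrightarrow> f x"
  proof (rule LIMSEQ_I)
    fix e :: real assume e: "e > 0"
    then obtain d where d: "d > 0" "\<And>y. dist y x < d \<Longrightarrow> dist (f y) (f x) < e / 2"
      using cont unfolding continuous_on_iff by (metis UNIV_I half_gt_zero)
    obtain n where n: "(1 / 2 :: real) ^ n < d"
      using real_arch_pow_inv[of d "1 / 2"] d by auto
    show "\<exists>no. \<forall>k\<ge>no. norm (avg m ((1 / 2) ^ k) f x - f x) < e"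
    proof (intro exI[of _ n] allI impI)
      fix k assume "n \<le> k"
      let ?r = "(1 / 2 :: real) ^ k"
      have r: "?r < d" by (rule le_less_trans[OF power_decreasing[OF \<open>n \<le> k\<close>] n]) auto
      have V: "0 < emeasure m (ball x ?r)" by (simp add: m_ball_pos)
      have "ennreal \<bar>f x - avg m ?r f x\<bar> \<le> (1 / emeasure m (ball x ?r)) * (\<integral>\<^sup>+y\<in>ball x ?r. ennreal \<bar>f x - f y\<bar> \<partial>m)"
        unfolding avg_def using V by (intro average_diff_le Lp_set_integrable f) auto
      also have "\<dots> \<le> (1 / emeasure m (ball x ?r)) * (\<integral>\<^sup>+y\<in>ball x ?r. ennreal (e / 2) \<partial>m)"
      proof (intro mult_left_mono nn_integral_mono)
        fix y
        show "ennreal \<bar>f x - f y\<bar> * indicator (ball x ?r) y \<le> ennreal (e / 2) * indicator (ball x ?r) y"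
          using d(2)[of y] r by (auto simp: dist_commute dist_real_def intro!: ennreal_leI split: split_indicator)
      qed auto
      also have "\<dots> = ennreal (e / 2) * (emeasure m (ball x ?r) / emeasure m (ball x ?r))"
        by (simp add: nn_integral_cmult_indicator ennreal_divide_times mult.commute ennreal_times_divide)
      also have "\<dots> = ennreal (e / 2)" using V by simp
      finally show "norm (avg m ?r f x - f x) < e" using e by (simp add: abs_minus_commute)
    qed
  qed
  then show ?thesis by (simp add: trace_op_def limI)
qed

lemma continuous_linear_trace_op:
  "continuous_linear_operator m (besov_space \<alpha> p q m) (besov_norm \<alpha> p q m) \<mu> (besov_space \<beta> p q \<mu>)
    (besov_norm \<beta> p q \<mu>) (trace_op m)"
  unfolding continuous_linear_operator_def
proof (intro conjI ballI allI impI)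
  obtain c where c: "c > 0"
    "\<And>f. f \<in> Lp \<Longrightarrow> besov_norm \<beta> p q \<mu> (trace_op m f) \<le> ennreal c * besov_norm \<alpha> p q m f"
    "\<And>f. f \<in> Lp \<Longrightarrow> btail f 0 \<le> ennreal c * ennpowr (besov_norm \<alpha> p q m f) p"
    using besov_norm_trace_le by blast
  note Lp = besov_space_subset_Lp
  note conv = AE_convergent_avg_besov
  {
    fix f assume f: "f \<in> besov_space \<alpha> p q m"
    have "besov_norm \<alpha> p q m f < \<infinity>" using f by (simp add: besov_space_def)
    then have "besov_norm \<beta> p q \<mu> (trace_op m f) < \<infinity>"
      using c(2)[OF Lp[OF f]] by (auto simp: ennreal_mult_less_top intro: le_less_trans)
    then show "trace_op m f \<in> besov_space \<beta> p q \<mu>"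
      using Lp_trace_measurable[OF Lp[OF f]] by (simp add: besov_space_def measurable_cong_sets[OF sets_\<mu> refl])
  next
    fix f g assume fg: "f \<in> besov_space \<alpha> p q m" "g \<in> besov_space \<alpha> p q m" and eq: "AE x in m. f x = g x"
    \<comment> \<open>Averages do not see null sets of \<open>m\<close>, so the two traces agree
      even pointwise.\<close>
    have "avg m r f x = avg m r g x" for r x
    proof -
      have "(LINT y:ball x r|m. f y) = (LINT y:ball x r|m. g y)"
        using fg eq by (intro set_lebesgue_integral_cong_AE) (auto simp: besov_space_def)
      then show ?thesis by (simp add: avg_def)
    qed
    then show "AE x in \<mu>. trace_op m f x = trace_op m g x" by (simp add: trace_op_def)
  next
    fix f g assume fg: "f \<in> besov_space \<alpha> p q m" "g \<in> besov_space \<alpha> p q m"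
    show "AE x in \<mu>. trace_op m (\<lambda>y. f y + g y) x = trace_op m f x + trace_op m g x"
      using conv[OF fg(1)] conv[OF fg(2)]
    proof eventually_elim
      case (elim x)
      then show ?case
        by (auto simp: trace_op_def avg_add Lp fg convergent_LIMSEQ_iff intro!: limI tendsto_add)
    qed
  next
    fix a f assume f: "f \<in> besov_space \<alpha> p q m"
    show "AE x in \<mu>. trace_op m (\<lambda>y. a * f y) x = a * trace_op m f x"
      using conv[OF f]
    proof eventually_elim
      case (elim x)
      then show ?case
        by (auto simp: trace_op_def avg_scale convergent_LIMSEQ_iff intro!: limI tendsto_mult_left)
    qed
  next
    fix f \<epsilon> :: _ assume f: "f \<in> besov_space \<alpha> p q m" and \<epsilon>: "(0::real) < \<epsilon>"
    show "\<exists>\<eta>>0. \<forall>g\<in>besov_space \<alpha> p q m. besov_norm \<alpha> p q m (\<lambda>y. g y - f y) < ennreal \<eta> \<longrightarrow>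
        besov_norm \<beta> p q \<mu> (\<lambda>x. trace_op m g x - trace_op m f x) < ennreal \<epsilon>"
    \<comment> \<open>\<open>c\<close> is the constant of the norm bound, so the same
      \<open>\<epsilon> / c\<close> works for every \<open>f\<close>.\<close>
    proof (intro exI[of _ "\<epsilon> / c"] conjI ballI impI)
      show "\<epsilon> / c > 0" using \<epsilon> c by simp
      fix g assume g: "g \<in> besov_space \<alpha> p q m" and lt: "besov_norm \<alpha> p q m (\<lambda>y. g y - f y) < ennreal (\<epsilon> / c)"
      \<comment> \<open>Finiteness of the norm of the difference comes from the assumed bound by
        \<open>\<epsilon> / c\<close>.\<close>
      then have d: "(\<lambda>y. g y - f y) \<in> besov_space \<alpha> p q m"
        using f by (auto simp: besov_space_def intro: less_trans)
      have "AE x in \<mu>. trace_op m g x - trace_op m f x = trace_op m (\<lambda>y. g y - f y) x"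
        using conv[OF f] conv[OF g]
      proof eventually_elim
        case (elim x)
        then show ?case
          by (auto simp: trace_op_def avg_diff Lp f g convergent_LIMSEQ_iff intro!: limI[symmetric] tendsto_diff)
      qed
      \<comment> \<open>The two functions agree where both sequences of averages converge, which is
        enough for equal norms.\<close>
      then have "besov_norm \<beta> p q \<mu> (\<lambda>x. trace_op m g x - trace_op m f x) = besov_norm \<beta> p q \<mu> (trace_op m (\<lambda>y. g y - f y))"
        by (rule besov_norm_cong_AE)
      also have "\<dots> \<le> ennreal c * besov_norm \<alpha> p q m (\<lambda>y. g y - f y)"
        by (rule c(2)[OF Lp[OF d]])
      also have "\<dots> < ennreal c * ennreal (\<epsilon> / c)"
        using lt c by (intro ennreal_mult_strict_left_mono) auto
      also have "\<dots> = ennreal \<epsilon>"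
        using c \<epsilon> by (simp flip: ennreal_mult)
      finally show "besov_norm \<beta> p q \<mu> (\<lambda>x. trace_op m g x - trace_op m f x) < ennreal \<epsilon>" .
    qed
  }
qed

lemma trace_op_restrict_space:
  assumes "F \<in> sets \<mu>"
  shows "continuous_linear_operator m (besov_space \<alpha> p q m) (besov_norm \<alpha> p q m)
      (restrict_space \<mu> F) (besov_space \<beta> p q (restrict_space \<mu> F))
        (besov_norm \<beta> p q (restrict_space \<mu> F)) (trace_op m)"
    and "\<forall>f\<in>besov_space \<alpha> p q m. continuous_on UNIV f \<longrightarrow> (AE x in restrict_space \<mu> F. trace_op m f x = f x)"
proof -
  have norm: "besov_norm \<beta> p q (restrict_space \<mu> F) = besov_norm \<beta> p q \<mu>"
    using assms F by (intro ext besov_norm_restrict_space) auto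
  have sub: "u \<in> besov_space \<beta> p q (restrict_space \<mu> F)" if "u \<in> besov_space \<beta> p q \<mu>" for u
    using that by (auto simp: besov_space_def norm intro: measurable_restrict_space1)
  have AE: "AE x in restrict_space \<mu> F. P x" if "AE x in \<mu>. P x" for P
    using that assms by (subst AE_restrict_space_iff) auto
  show "continuous_linear_operator m (besov_space \<alpha> p q m) (besov_norm \<alpha> p q m)
      (restrict_space \<mu> F) (besov_space \<beta> p q (restrict_space \<mu> F))
        (besov_norm \<beta> p q (restrict_space \<mu> F)) (trace_op m)"
    using continuous_linear_trace_op unfolding continuous_linear_operator_def norm
    by (auto intro!: sub AE)
  show "\<forall>f\<in>besov_space \<alpha> p q m. continuous_on UNIV f \<longrightarrow> (AE x in restrict_space \<mu> F. trace_op m f x = f x)"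
    using trace_op_continuous besov_space_subset_Lp by auto
qed

end


section \<open>Ahlfors regular spaces\<close>

text \<open>A bounded space would be a single ball, of finite measure. Infinite diameter makes the
  lower bound for \<open>m\<close> available at every radius.\<close>

lemma ahlfors_regular_infinite_ediam:
  fixes m :: "'a::metric_space measure"
  assumes "space m = UNIV" "ahlfors_regular N m" "emeasure m UNIV = \<infinity>"
  shows "ediam (UNIV :: 'a set) = \<infinity>"
proof (rule ccontr)
  assume "ediam (UNIV :: 'a set) \<noteq> \<infinity>"
  then obtain d where d: "ediam (UNIV :: 'a set) = ennreal d" "d \<ge> 0"
    by (cases "ediam (UNIV :: 'a set)") auto
  obtain c where c: "\<And>(x::'a) r. r > 0 \<Longrightarrow> emeasure m (ball x r) \<le> ennreal (c * r powr N)"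
    using ahlfors_regular_ball_bounds[OF assms(2)] assms(1) by auto
  have "dist undefined x \<le> d" for x :: 'a
    using dist_le_ediam[of undefined UNIV x] d by simp
  then have "x \<in> ball undefined (d + 1)" for x :: 'a
    using le_less_trans[of "dist undefined x" d "d + 1"] by simp
  then have "ball (undefined :: 'a) (d + 1) = UNIV" by blast
  with c[of "d + 1" undefined] d(2) assms(3) show False by (simp add: top_unique)
qed

lemma besov_trace_setting_exists:
  fixes m \<mu> :: "'a::metric_space measure" and F :: "'a set" and N \<delta> \<alpha> \<beta> p q :: real
  assumes sets_m: "sets m = sets borel" and m: "ahlfors_regular N m" and inf: "emeasure m UNIV = \<infinity>"
    and "closed F" and sets_\<mu>: "sets \<mu> = sets borel" and \<mu>F: "emeasure \<mu> (- F) = 0"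
    and \<mu>: "ahlfors_regular \<delta> (restrict_space \<mu> F)" and \<delta>: "\<delta> < N"
    and p: "1 < p" and \<beta>: "\<beta> = \<alpha> - (N - \<delta>) / p" "\<beta> > 0" and q: "1 \<le> q"
  obtains D C K L E where "besov_trace_setting m \<mu> F D N \<delta> C K L E p \<alpha> \<beta> q"
proof -
  have sp: "space m = UNIV" "space \<mu> = UNIV"
    using sets_eq_imp_space_eq[OF sets_m] sets_eq_imp_space_eq[OF sets_\<mu>] by auto
  have N: "N > 0" and \<delta>0: "\<delta> > 0"
    using m \<mu> by (auto simp: ahlfors_regular_def)
  have diam: "ediam (UNIV :: 'a set) = \<infinity>"
    by (rule ahlfors_regular_infinite_ediam[OF sp(1) m inf])
  obtain c where c: "c > 0" "\<And>(x::'a) r. r > 0 \<Longrightarrow> emeasure m (ball x r) \<le> ennreal (c * r powr N)"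
    "\<And>(x::'a) r. r > 0 \<Longrightarrow> ennreal (r powr N / c) \<le> emeasure m (ball x (2 * r))"
    using ahlfors_regular_ball_bounds[OF m] sp diam by auto
  \<comment> \<open>The factor \<open>2 powr N\<close> comes from using the lower bound at
    \<open>r / 2\<close>, as \<open>ahlfors_regular\<close> speaks of balls of radius
    \<open>2 * r\<close>.\<close>
  define C where "C = 2 powr N * c"
  have C: "C > 0" using c by (simp add: C_def)
  have m_upper: "emeasure m (ball x r) \<le> ennreal (C * r powr N)" if "r > 0" for x r
  proof -
    have "c \<le> C" using c N powr_mono[of 0 N 2] by (simp add: C_def)
    then show ?thesis
      using c(2)[OF that, of x] by (meson ennreal_leI mult_right_mono order_trans powr_ge_zero)
  qed
  have m_lower: "ennreal (r powr N / C) \<le> emeasure m (ball x r)" if "r > 0" for x r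
  proof -
    have "r powr N / C = (r / 2) powr N / c" using that by (simp add: C_def powr_divide)
    then show ?thesis using c(3)[of "r / 2" x] that by simp
  qed
  have "\<exists>c>0. \<forall>x. ennreal c \<le> emeasure m (ball x r)" if "r > 0" for r
    using m_lower[OF that] C that by (intro exI[of _ "r powr N / C"]) auto
  then obtain D :: "'a set" where D: "countable D" "\<And>x e. e > 0 \<Longrightarrow> \<exists>d\<in>D. dist x d < e"
    using countable_dense_if_ball_bounds[OF sets_m] m_upper by (metis ennreal_less_top infinity_ennreal_def order_le_less_trans)
  have F: "AE x in \<mu>. x \<in> F"
    using \<mu>F \<open>closed F\<close> by (intro AE_I[of _ _ "- F"]) (auto simp: sets_\<mu>)
  have ball_F: "emeasure (restrict_space \<mu> F) (ball x r \<inter> F) = emeasure \<mu> (ball x r)" for x r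
    using F \<open>closed F\<close> by (subst emeasure_restrict_space) (auto simp: sp sets_\<mu> intro!: emeasure_eq_AE)
  have spF: "space (restrict_space \<mu> F) = F" by (simp add: space_restrict_space sp)
  obtain c' where c': "c' > 0" "\<And>x r. x \<in> F \<Longrightarrow> r > 0 \<Longrightarrow> emeasure \<mu> (ball x r) \<le> ennreal (c' * r powr \<delta>)"
    "\<And>x r. x \<in> F \<Longrightarrow> r > 0 \<Longrightarrow> ennreal r < ediam F \<Longrightarrow> ennreal (r powr \<delta> / c') \<le> emeasure \<mu> (ball x (2 * r))"
    using ahlfors_regular_ball_bounds[OF \<mu>] unfolding spF ball_F by blast
  have "ediam F > 0" using \<mu> by (simp add: ahlfors_regular_def spF)
  then obtain d where d: "d > 0" "ennreal d < ediam F"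
  proof (cases "ediam F")
    case (real e)
    then show ?thesis
      using \<open>ediam F > 0\<close> that[of "e / 2"] by (simp add: ennreal_less_iff)
  next
    case top
    then show ?thesis using that[of 1] by simp
  qed
  \<comment> \<open>For \<open>r \<le> 1\<close>, the radius \<open>h * r\<close> is at most
    \<open>d\<close>, hence below the diameter of \<open>F\<close>, and the ball of radius
    \<open>2 * (h * r)\<close> lies inside that of radius \<open>r\<close>.\<close>
  define h where "h = min (1 / 2) d"
  have h: "h > 0" "h \<le> 1 / 2" "h \<le> d" using d by (auto simp: h_def)
  \<comment> \<open>A ball that meets \<open>F\<close> lies in a ball of twice the radius with
    centre in \<open>F\<close>.\<close>
  define K where "K = c' * 2 powr \<delta>"
  define L where "L = c' / h powr \<delta>"
  \<comment> \<open>The product covers radii below twice the diameter of \<open>F\<close>; the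
    summand 1 covers larger ones, where both balls contain \<open>F\<close> and have equal
    mass.\<close>
  define E where "E = c' * c' * 2 powr \<delta> + 1"
  have "besov_trace_setting m \<mu> F D N \<delta> C K L E p \<alpha> \<beta> q"
  proof (unfold_locales)
    show "C > 0" "K > 0" "L > 0" "E > 0" using C c' h by (auto simp: K_def L_def E_def add_pos_pos)
    show "emeasure \<mu> (ball x r) \<le> ennreal (K * r powr \<delta>)" if r: "r > 0" for x r
    proof (cases "ball x r \<inter> F = {}")
      case True
      have "AE z in \<mu>. z \<notin> ball x r"
        using F by eventually_elim (use True in blast)
      then have "emeasure \<mu> (ball x r) = emeasure \<mu> {}"
        by (intro emeasure_eq_AE) (auto simp: sets_\<mu>)
      then show ?thesis by simp
    next
      case False
      then obtain y where y: "y \<in> F" "dist x y < r" by auto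
      have "ball x r \<subseteq> ball y (2 * r)"
      proof
        fix z assume "z \<in> ball x r"
        then show "z \<in> ball y (2 * r)"
          using dist_triangle[of y z x] y by (simp add: dist_commute)
      qed
      then have "emeasure \<mu> (ball x r) \<le> emeasure \<mu> (ball y (2 * r))"
        by (intro emeasure_mono) (auto simp: sets_\<mu>)
      also have "\<dots> \<le> ennreal (c' * (2 * r) powr \<delta>)" using y r by (intro c') auto
      also have "c' * (2 * r) powr \<delta> = K * r powr \<delta>" using r by (simp add: K_def powr_mult)
      finally show ?thesis .
    qed
    show "ennreal (r powr \<delta> / L) \<le> emeasure \<mu> (ball x r)" if x: "x \<in> F" and r: "0 < r" "r \<le> 1" for x r
    proof -
      have hr: "h * r \<le> d" "2 * (h * r) \<le> r"
        using h r mult_mono[of h d r 1] by (auto simp: mult_right_mono)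
      have "r powr \<delta> / L = (h * r) powr \<delta> / c'" using h r by (simp add: L_def powr_mult)
      also have "ennreal ((h * r) powr \<delta> / c') \<le> emeasure \<mu> (ball x (2 * (h * r)))"
        using h r hr d by (intro c' x) (auto intro: le_less_trans[OF ennreal_leI])
      also have "\<dots> \<le> emeasure \<mu> (ball x r)"
        using hr by (intro emeasure_mono) (auto simp: sets_\<mu>)
      finally show ?thesis .
    qed
    show "emeasure \<mu> (ball y r) \<le> ennreal E * emeasure \<mu> (ball x r)" if xy: "x \<in> F" "y \<in> F" "dist x y < r" for x y r
    proof (cases "ennreal (r / 2) < ediam F")
      case True
      have r: "r > 0" using xy(3) by (rule le_less_trans[rotated]) simp
      have "emeasure \<mu> (ball y r) \<le> ennreal (c' * r powr \<delta>)" by (intro c' xy r)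
      also have "\<dots> = ennreal (c' * c' * 2 powr \<delta>) * ennreal ((r / 2) powr \<delta> / c')"
        using r c' by (simp add: powr_divide flip: ennreal_mult)
      also have "\<dots> \<le> ennreal (c' * c' * 2 powr \<delta>) * emeasure \<mu> (ball x (2 * (r / 2)))"
        using r True by (intro mult_left_mono c' xy) auto
      also have "\<dots> \<le> ennreal E * emeasure \<mu> (ball x (2 * (r / 2)))"
        by (intro mult_right_mono ennreal_leI) (auto simp: E_def)
      finally show ?thesis by simp
    next
      case False
      have "dist z w < r" if "z \<in> F" "w \<in> F" for z w
      proof -
        have r: "r > 0" using xy(3) by (rule le_less_trans[rotated]) simp
        have "ennreal (dist z w) \<le> ennreal (r / 2)"
          using dist_le_ediam[OF that] False by simp
        then show ?thesis using r by simp
      qed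
      then have "emeasure \<mu> (ball y r) = emeasure \<mu> (ball x r)"
        using F xy by (intro emeasure_eq_AE) (auto simp: sets_\<mu>)
      also have "\<dots> \<le> ennreal E * emeasure \<mu> (ball x r)"
        using c' mult_right_mono[of 1 "ennreal E" "emeasure \<mu> (ball x r)"] by (simp add: E_def)
      finally show ?thesis .
    qed
    have "(N - \<delta>) / p > 0" using \<delta> p by simp
    with \<beta> show "\<alpha> > 0" by simp
  qed (use assms D F m_upper m_lower N in auto)
  then show ?thesis by (rule that)
qed

theorem theorem5p4:
  fixes m \<mu> :: "'a::metric_space measure" and F :: "'a set"
    and s :: "'a \<Rightarrow> 'a \<Rightarrow> real \<Rightarrow> real"
    and N \<delta> \<alpha>\<^sub>0 \<alpha> \<beta> p q :: real
  assumes "sets m = sets borel" and "ahlfors_regular N m" and "emeasure m UNIV = \<infinity>"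
    and "closed F"
    and "sets \<mu> = sets borel" and "emeasure \<mu> (- F) = 0"
    and "ahlfors_regular \<delta> (restrict_space \<mu> F)" and "0 < \<delta>" and "\<delta> < N"
    and "approx_identity N m s" and "potential_exponent m s \<alpha>\<^sub>0"
    and "\<alpha> < \<alpha>\<^sub>0" and "1 < p" and "\<beta> = \<alpha> - (N - \<delta>) / p" and "\<beta> > 0" and "1 \<le> q"
  shows "\<exists>R :: ('a \<Rightarrow> real) \<Rightarrow> 'a \<Rightarrow> real.
    continuous_linear_operator
      m (besov_space \<alpha> p q m) (besov_norm \<alpha> p q m)
      (restrict_space \<mu> F) (besov_space \<beta> p q (restrict_space \<mu> F))
        (besov_norm \<beta> p q (restrict_space \<mu> F))
      R \<and>
    (\<forall>f\<in>besov_space \<alpha> p q m. continuous_on UNIV f \<longrightarrow>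
       (AE x in restrict_space \<mu> F. R f x = f x))"
proof -
  obtain D C K L E where S: "besov_trace_setting m \<mu> F D N \<delta> C K L E p \<alpha> \<beta> q"
    by (rule besov_trace_setting_exists[OF assms(1-7,9,13-16)])
  have "F \<in> sets \<mu>" using assms by simp
  from besov_trace_setting.trace_op_restrict_space[OF S this] show ?thesis
    by (intro exI[of _ "trace_op m"] conjI)
qed

end
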